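(* Consider a system of $N$ qubits placed on the sites of a lattice, with a target Hamiltonian $H$ and an actual Hamiltonian $$H' = H + \sum_{i=1}^M g_i V_i,$$ where $M=\mathcal{O}(N)$, each $V_i$ is a local Hermitian operator with $\|V_i\|\le 1$, and $g_1,\dots,g_M$ are independent $\chi$-deformed Gaussian random variables with parameters $\delta>0$ and $\Gamma\in(0,+\infty]$. Suppose $\sqrt{N}t\delta\le\mathcal{O}(1)$. Then for any density matrix $\rho$ and observable $O$, with $O(t)=e^{iHt}Oe^{-iHt}$ and $O'(t)=e^{iH't}Oe^{-iH't}$, $$\big|\mathbb{E}_{\{g_i\}}[\mathrm{tr}[\rho O'(t)]] - \mathrm{tr}[\rho O(t)]\big| = \mathcal{O}(N\delta^2t^2\|O\|).$$
   Context: A random variable $g$ is a $\chi$-deformed Gaussian random variable (with parameters $\delta>0$, $\Gamma\in(0,+\infty]$) if $g=\chi(\theta)$ for some $\theta\sim\mathcal{N}(0,1)$, where $\chi:\mathbb{R}\to\mathbb{R}$ is a strictly monotonically increasing differentiable function with $|\mathrm{d}\chi(\theta)/\mathrm{d}\theta|\le\delta$ for all $\theta$, $\chi(0)=0$, $\lim_{\theta\to+\infty}\chi(\theta)=\Gamma$, $\lim_{\theta\to-\infty}\chi(\theta)=-\Gamma$, and $\mathbb{E}[\chi(\theta)]=0$. Independence of the $g_i$ means the underlying Gaussians $\theta_i$ are independent. $\|\cdot\|$ denotes the operator norm. The $\mathcal{O}(\cdot)$ notation hides constants independent of $N$, $t$, $\delta$, $\rho$, $O$. *)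

theory Defs
  imports "HOL-Probability.Probability" "Jordan_Normal_Form.Matrix"
begin

definition adj :: "complex mat \<Rightarrow> complex mat" where
  "adj A = mat (dim_col A) (dim_row A) (\<lambda>(i,j). cnj (A $$ (j,i)))"

definition hermitian_mat :: "nat \<Rightarrow> complex mat \<Rightarrow> bool" where
  "hermitian_mat n A \<longleftrightarrow> A \<in> carrier_mat n n \<and> adj A = A"

definition mtrace :: "complex mat \<Rightarrow> complex" where
  "mtrace A = (\<Sum>i<dim_row A. A $$ (i,i))"

definition cvnorm :: "complex vec \<Rightarrow> real" where
  "cvnorm v = sqrt (\<Sum>i<dim_vec v. (cmod (v $ i))\<^sup>2)"

definition opnorm :: "complex mat \<Rightarrow> real" where
  "opnorm A = Sup {cvnorm (A *\<^sub>v v) | v. v \<in> carrier_vec (dim_col A) \<and> cvnorm v \<le> 1}"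

definition density_matrix :: "nat \<Rightarrow> complex mat \<Rightarrow> bool" where
  "density_matrix n \<rho> \<longleftrightarrow> hermitian_mat n \<rho> \<and> mtrace \<rho> = 1 \<and>
     (\<forall>v \<in> carrier_vec n. 0 \<le> Re (\<Sum>i<n. cnj (v $ i) * (\<rho> *\<^sub>v v) $ i))"

definition mat_exp :: "complex mat \<Rightarrow> complex mat" where
  "mat_exp A = mat (dim_row A) (dim_col A)
     (\<lambda>(i,j). (\<Sum>k. (A ^\<^sub>m k) $$ (i,j) / of_nat (fact k)))"

definition heis :: "complex mat \<Rightarrow> complex mat \<Rightarrow> real \<Rightarrow> complex mat" where
  "heis H Ob t = mat_exp ((\<i> * of_real t) \<cdot>\<^sub>m H) * Ob * mat_exp ((- \<i> * of_real t) \<cdot>\<^sub>m H)"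

definition perturbed :: "nat \<Rightarrow> complex mat \<Rightarrow> nat \<Rightarrow> (nat \<Rightarrow> complex mat) \<Rightarrow> (nat \<Rightarrow> real) \<Rightarrow> complex mat" where
  "perturbed n H M V g = H + mat n n (\<lambda>(a,b). \<Sum>i<M. of_real (g i) * (V i $$ (a,b)))"

definition std_normal :: "real measure" where
  "std_normal = density lborel std_normal_density"

definition chi_deformation :: "real \<Rightarrow> ereal \<Rightarrow> (real \<Rightarrow> real) \<Rightarrow> bool" where
  "chi_deformation \<delta> \<Gamma> chi \<longleftrightarrow>
     \<delta> > 0 \<and> \<Gamma> > 0 \<and>
     strict_mono chi \<and>
     (\<forall>\<theta>. chi differentiable (at \<theta>)) \<and>
     (\<forall>\<theta>. \<bar>deriv chi \<theta>\<bar> \<le> \<delta>) \<and>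
     chi 0 = 0 \<and>
     ((\<lambda>\<theta>. ereal (chi \<theta>)) \<longlongrightarrow> \<Gamma>) at_top \<and>
     ((\<lambda>\<theta>. ereal (chi \<theta>)) \<longlongrightarrow> - \<Gamma>) at_bot \<and>
     integrable std_normal chi \<and> (\<integral>\<theta>. chi \<theta> \<partial>std_normal) = 0"

definition expect_g :: "nat \<Rightarrow> (nat \<Rightarrow> real \<Rightarrow> real) \<Rightarrow> ((nat \<Rightarrow> real) \<Rightarrow> complex) \<Rightarrow> complex" where
  "expect_g M chi F = (\<integral>\<theta>. F (\<lambda>i. chi i (\<theta> i)) \<partial>(PiM {..<M} (\<lambda>_. std_normal)))"

end

theory Submission
  imports Defs
begin

text \<open>Write \<open>F(g) = tr(\<rho> O'(t))\<close>. Switching off the couplings one at a time (Lindeberg's telescoping)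
  turns the difference of expectations into \<open>M\<close> terms, each involving \<open>F\<close> as a function of a single
  coupling \<open>g\<^sub>i\<close> with the others fixed. In that variable \<open>F\<close> has a first-order expansion
  \<open>F(0) + L g\<^sub>i\<close> with remainder at most \<open>2 t\<^sup>2 g\<^sub>i\<^sup>2 \<parallel>O\<parallel>\<close>, uniformly in the others because all
  evolutions are unitary. The linear term disappears since \<open>E g\<^sub>i = 0\<close>, and
  \<open>E g\<^sub>i\<^sup>2 \<le> \<delta>\<^sup>2 E \<theta>\<^sup>2 = \<delta>\<^sup>2\<close> because \<open>\<chi>\<close> is \<open>\<delta>\<close>-Lipschitz with \<open>\<chi>(0) = 0\<close>. The total error is
  therefore at most \<open>2 M \<delta>\<^sup>2 t\<^sup>2 \<parallel>O\<parallel>\<close>.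

  The expansion of \<open>F\<close> is obtained on state vectors: the Cholesky decomposition \<open>\<rho> = \<Sum> w\<^sub>k w\<^sub>k\<^sup>*\<close> reduces the
  trace to quadratic forms in the solutions of the Schroedinger equation, which are compared by an
  energy estimate.\<close>

unbundle no vec_syntax

section \<open>Euclidean norm and operator norm\<close>

text \<open>Conjugate-linear in the first argument. The index range is read off the second argument,
  so laws that rearrange the first one carry dimension hypotheses.\<close>

definition cinner :: "complex vec \<Rightarrow> complex vec \<Rightarrow> complex" where
  "cinner u v = (\<Sum>i<dim_vec v. cnj (u $ i) * v $ i)"

lemma cvnorm_L2_set: "cvnorm v = L2_set (\<lambda>i. cmod (v $ i)) {..<dim_vec v}"
  by (simp add: cvnorm_def L2_set_def)

lemma cvnorm_nonneg [simp]: "0 \<le> cvnorm v"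
  by (simp add: cvnorm_L2_set L2_set_nonneg)

lemma cvnorm_power2: "(cvnorm v)\<^sup>2 = (\<Sum>i<dim_vec v. (cmod (v $ i))\<^sup>2)"
  unfolding cvnorm_def by (simp add: sum_nonneg)

lemma cvnorm_smult: "cvnorm (c \<cdot>\<^sub>v v) = cmod c * cvnorm v"
  by (simp add: cvnorm_def norm_mult power_mult_distrib real_sqrt_mult flip: sum_distrib_left)

lemma cmod_cinner_le:
  assumes "u \<in> carrier_vec n" "v \<in> carrier_vec n"
  shows "cmod (cinner u v) \<le> cvnorm u * cvnorm v"
proof -
  have "cmod (cinner u v) \<le> (\<Sum>i<n. \<bar>cmod (u $ i)\<bar> * \<bar>cmod (v $ i)\<bar>)"
    using assms unfolding cinner_def by (auto intro!: sum_norm_le simp: norm_mult)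
  also have "\<dots> \<le> cvnorm u * cvnorm v"
    using assms L2_set_mult_ineq[of "\<lambda>i. cmod (u $ i)" "\<lambda>i. cmod (v $ i)" "{..<n}"]
    by (simp add: cvnorm_L2_set)
  finally show ?thesis .
qed

lemma cinner_self: "cinner v v = of_real ((cvnorm v)\<^sup>2)"
  unfolding cvnorm_power2 cinner_def of_real_sum
  by (intro sum.cong refl) (metis complex_norm_square mult.commute of_real_power)

lemma cnj_cinner:
  assumes "u \<in> carrier_vec n" "v \<in> carrier_vec n"
  shows "cnj (cinner u v) = cinner v u"
  using assms by (simp add: cinner_def mult.commute)

lemma cinner_add_right:
  assumes "v \<in> carrier_vec n" "w \<in> carrier_vec n"
  shows "cinner u (v + w) = cinner u v + cinner u w"
  using assms by (simp add: cinner_def distrib_left sum.distrib)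

lemma cinner_add_left:
  assumes "u \<in> carrier_vec n" "v \<in> carrier_vec n" "w \<in> carrier_vec n"
  shows "cinner (u + v) w = cinner u w + cinner v w"
  using assms by (simp add: cinner_def distrib_right sum.distrib)

lemma cinner_smult_right: "cinner u (c \<cdot>\<^sub>v v) = c * cinner u v"
  by (simp add: cinner_def sum_distrib_left mult_ac)

lemma cinner_smult_left:
  assumes "u \<in> carrier_vec n" "v \<in> carrier_vec n"
  shows "cinner (c \<cdot>\<^sub>v u) v = cnj c * cinner u v"
  using assms by (simp add: cinner_def sum_distrib_left mult_ac)

lemma mult_mat_vec_index:
  assumes "A \<in> carrier_mat m n" "v \<in> carrier_vec n" "i < m"
  shows "(A *\<^sub>v v) $ i = (\<Sum>j<n. A $$ (i,j) * v $ j)"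
  using assms by (simp add: scalar_prod_def atLeast0LessThan)

lemma hermitian_mat_carrier: "hermitian_mat n A \<Longrightarrow> A \<in> carrier_mat n n"
  by (simp add: hermitian_mat_def)

lemma adj_carrier: "A \<in> carrier_mat m n \<Longrightarrow> adj A \<in> carrier_mat n m"
  by (simp add: adj_def)

lemma cinner_mult_mat_vec:
  assumes A: "A \<in> carrier_mat m n" and "u \<in> carrier_vec m" "v \<in> carrier_vec n"
  shows "cinner u (A *\<^sub>v v) = cinner (adj A *\<^sub>v u) v"
proof -
  have "cinner u (A *\<^sub>v v) = (\<Sum>i<m. \<Sum>j<n. cnj (u $ i) * (A $$ (i,j) * v $ j))"
    using assms by (simp add: cinner_def mult_mat_vec_index[of _ m n] sum_distrib_left del: index_mult_mat_vec(1))
  also have "\<dots> = (\<Sum>j<n. \<Sum>i<m. cnj (u $ i) * (A $$ (i,j) * v $ j))"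
    by (rule sum.swap)
  also have "\<dots> = cinner (adj A *\<^sub>v u) v"
  proof -
    have "(adj A *\<^sub>v u) $ j = (\<Sum>i<m. cnj (A $$ (i,j)) * u $ i)" if "j < n" for j
      using mult_mat_vec_index[OF adj_carrier[OF A] assms(2) that] that A by (simp add: adj_def)
    then show ?thesis
      using assms by (simp add: cinner_def sum_distrib_left sum_distrib_right mult_ac
          del: index_mult_mat_vec(1))
  qed
  finally show ?thesis .
qed

text \<open>The form equals its own conjugate. In the energy estimate this makes a Hermitian
  generator drop out.\<close>

lemma Im_cinner_hermitian:
  assumes A: "hermitian_mat n A" and v: "v \<in> carrier_vec n"
  shows "Im (cinner v (A *\<^sub>v v)) = 0"
proof -
  have "A \<in> carrier_mat n n" "adj A = A"
    using A by (auto simp: hermitian_mat_def)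
  then have "cnj (cinner v (A *\<^sub>v v)) = cinner v (A *\<^sub>v v)"
    using cinner_mult_mat_vec[of A n n v v] cnj_cinner[of v n "A *\<^sub>v v"] v by simp
  then show ?thesis
    by (metis Reals_cnj_iff complex_is_Real_iff)
qed

section \<open>Bounds by the operator norm\<close>

text \<open>A real supremum is informative only over a bounded set. In the unit ball every
  coordinate has modulus at most 1, so the sum of the moduli of all matrix entries is an upper
  bound.\<close>

lemma bdd_above_opnorm:
  assumes A: "A \<in> carrier_mat m n"
  shows "bdd_above {cvnorm (A *\<^sub>v v) | v. v \<in> carrier_vec (dim_col A) \<and> cvnorm v \<le> 1}"
proof (rule bdd_aboveI)
  fix x assume "x \<in> {cvnorm (A *\<^sub>v v) | v. v \<in> carrier_vec (dim_col A) \<and> cvnorm v \<le> 1}"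
  then obtain v where v: "v \<in> carrier_vec n" "cvnorm v \<le> 1" and x: "x = cvnorm (A *\<^sub>v v)"
    using A by auto
  have le1: "cmod (v $ j) \<le> 1" if "j < n" for j
    using v member_le_L2_set[of "{..<n}" j "\<lambda>i. cmod (v $ i)"] that by (simp add: cvnorm_L2_set)
  have "x \<le> (\<Sum>i<m. cmod ((A *\<^sub>v v) $ i))"
    using A unfolding x cvnorm_L2_set by (simp add: L2_set_le_sum del: index_mult_mat_vec(1))
  also have "\<dots> \<le> (\<Sum>i<m. \<Sum>j<n. cmod (A $$ (i,j)))"
  proof (intro sum_mono)
    fix i assume "i \<in> {..<m}"
    then have "(A *\<^sub>v v) $ i = (\<Sum>j<n. A $$ (i,j) * v $ j)"
      using A v by (simp add: mult_mat_vec_index[of _ m n] del: index_mult_mat_vec(1))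
    also have "cmod \<dots> \<le> (\<Sum>j<n. cmod (A $$ (i,j)))"
      using le1 by (intro sum_norm_le) (auto simp: norm_mult mult_left_le)
    finally show "cmod ((A *\<^sub>v v) $ i) \<le> (\<Sum>j<n. cmod (A $$ (i,j)))" .
  qed
  finally show "x \<le> (\<Sum>i<m. \<Sum>j<n. cmod (A $$ (i,j)))" .
qed

lemma cvnorm_zero [simp]: "cvnorm (0\<^sub>v n) = 0"
  by (simp add: cvnorm_def)

lemma cvnorm_mult_mat_vec_le_opnorm:
  assumes A: "A \<in> carrier_mat m n" and v: "v \<in> carrier_vec n" "cvnorm v \<le> 1"
  shows "cvnorm (A *\<^sub>v v) \<le> opnorm A"
  unfolding opnorm_def using bdd_above_opnorm[OF A] A v by (intro cSup_upper) auto

lemma opnorm_nonneg: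
  assumes A: "A \<in> carrier_mat m n"
  shows "0 \<le> opnorm A"
  using cvnorm_mult_mat_vec_le_opnorm[OF A, of "0\<^sub>v n"] by (simp add: order_trans[OF cvnorm_nonneg])

lemma cvnorm_mult_mat_vec_le:
  assumes A: "A \<in> carrier_mat m n" and v: "v \<in> carrier_vec n"
  shows "cvnorm (A *\<^sub>v v) \<le> opnorm A * cvnorm v"
proof (cases "cvnorm v = 0")
  case True
  then have "v $ j = 0" if "j < n" for j
    using v that by (auto simp: cvnorm_L2_set L2_set_eq_0_iff)
  then have "v = 0\<^sub>v n"
    using v by auto
  then have "A *\<^sub>v v = 0\<^sub>v m"
    using A by auto
  then show ?thesis
    using True by simp
next
  case False
  define c where "c = complex_of_real (cvnorm v)"
  define u where "u = (1 / c) \<cdot>\<^sub>v v"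
  have c: "c \<noteq> 0" "cmod c = cvnorm v"
    using False by (auto simp: c_def)
  have u: "u \<in> carrier_vec n" "v = c \<cdot>\<^sub>v u" "cvnorm u \<le> 1"
    using v c False by (auto simp: u_def cvnorm_smult norm_divide smult_smult_assoc)
  have "A *\<^sub>v v = c \<cdot>\<^sub>v (A *\<^sub>v u)"
    using A u by auto
  then show ?thesis
    using cvnorm_mult_mat_vec_le_opnorm[OF A u(1,3)] c
    by (simp add: cvnorm_smult mult.commute mult_left_mono flip: c(2))
qed

section \<open>Energy estimate for the Schroedinger equation\<close>

text \<open>Half the derivative of the squared norm is \<open>Re (cinner r d)\<close>; dividing by
  the norm leaves a growth rate of at most \<open>b\<close>, with primitive \<open>B\<close>. The
  hypothesis bounds the inner product rather than the size of \<open>d\<close>, so a component of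
  \<open>d\<close> with no real overlap with \<open>r\<close> costs nothing.\<close>

lemma norm_le_integral_bound:
  fixes r d :: "real \<Rightarrow> complex vec" and b B :: "real \<Rightarrow> real"
  assumes carrier: "\<And>s. r s \<in> carrier_vec n" "\<And>s. d s \<in> carrier_vec n"
    and deriv: "\<And>s i. i < n \<Longrightarrow> ((\<lambda>s. r s $ i) has_vector_derivative d s $ i) (at s)"
    and bound: "\<And>s. 0 \<le> s \<Longrightarrow> s \<le> t \<Longrightarrow> Re (cinner (r s) (d s)) \<le> cvnorm (r s) * b s"
    and b: "\<And>s. 0 \<le> s \<Longrightarrow> s \<le> t \<Longrightarrow> 0 \<le> b s"
    and B: "\<And>s. (B has_real_derivative b s) (at s)"
    and t: "0 \<le> t"
  shows "cvnorm (r t) \<le> cvnorm (r 0) + (B t - B 0)"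
proof (rule field_le_epsilon)
  fix e :: real assume e: "0 < e"
  define E where "E s = (\<Sum>i<n. (Re (r s $ i))\<^sup>2 + (Im (r s $ i))\<^sup>2)" for s
  have E: "E s = (cvnorm (r s))\<^sup>2" for s
    using carrier[of s] by (simp add: E_def cvnorm_power2 cmod_power2)
  have dE: "(E has_real_derivative 2 * Re (cinner (r s) (d s))) (at s)" for s
  proof -
    have "((\<lambda>s. Re (r s $ i)) has_real_derivative Re (d s $ i)) (at s)"
         "((\<lambda>s. Im (r s $ i)) has_real_derivative Im (d s $ i)) (at s)" if "i < n" for i
      using deriv[OF that, of s] unfolding has_real_derivative_iff_has_vector_derivative
      by (auto intro: bounded_linear.has_vector_derivative[OF bounded_linear_Re]
                      bounded_linear.has_vector_derivative[OF bounded_linear_Im])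
    note d = this
    have "(E has_real_derivative
        (\<Sum>i<n. 2 * Re (r s $ i) * Re (d s $ i) + 2 * Im (r s $ i) * Im (d s $ i))) (at s)"
      unfolding E_def
      by (rule DERIV_sum, rule DERIV_cong[OF DERIV_add[OF DERIV_power[OF d(1)] DERIV_power[OF d(2)]]]) auto
    also have "(\<Sum>i<n. 2 * Re (r s $ i) * Re (d s $ i) + 2 * Im (r s $ i) * Im (d s $ i))
        = 2 * Re (cinner (r s) (d s))"
      using carrier[of s] by (simp add: cinner_def sum_distrib_left Re_sum distrib_left mult_ac)
    finally show ?thesis .
  qed
  have pos: "0 < E s + e\<^sup>2" for s
    using e by (simp add: E add_nonneg_pos)
  \<comment> \<open>The norm need not be differentiable where \<open>r\<close> vanishes. The shift
    by \<open>e\<^sup>2\<close> smooths it and costs at most \<open>e\<close>.\<close>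
  define m where "m s = sqrt (E s + e\<^sup>2)" for s
  have m: "0 < m s" "cvnorm (r s) \<le> m s" for s
    using pos[of s] e by (auto simp: m_def E intro!: real_le_rsqrt)
  have "m t - B t \<le> m 0 - B 0"
  proof (rule DERIV_nonpos_imp_nonincreasing[OF t])
    fix s assume s: "0 \<le> s" "s \<le> t"
    have "((\<lambda>s. m s - B s) has_real_derivative Re (cinner (r s) (d s)) / m s - b s) (at s)"
      unfolding m_def using pos[of s]
      by (auto intro!: derivative_eq_intros dE B simp: field_simps)
    \<comment> \<open>Nonnegativity of \<open>b\<close> allows the norm in the hypothesis to be
      enlarged to \<open>m s\<close>.\<close>
    moreover have "Re (cinner (r s) (d s)) \<le> m s * b s"
      using bound[OF s] mult_right_mono[OF m(2) b[OF s], of s] by linarith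
    then have "Re (cinner (r s) (d s)) / m s - b s \<le> 0"
      using m(1)[of s] by (simp add: divide_le_eq mult.commute)
    ultimately show "\<exists>y. ((\<lambda>s. m s - B s) has_real_derivative y) (at s) \<and> y \<le> 0"
      by blast
  qed
  moreover have "m 0 \<le> cvnorm (r 0) + e"
    unfolding m_def E using sqrt_add_le_add_sqrt[of "(cvnorm (r 0))\<^sup>2" "e\<^sup>2"] e by simp
  ultimately show "cvnorm (r t) \<le> cvnorm (r 0) + (B t - B 0) + e"
    using m(2)[of t] by linarith
qed

text \<open>The term \<open>-i A r\<close> has purely imaginary inner product with \<open>r\<close>,
  so only the source \<open>f\<close> makes the norm grow. This one estimate replaces both unitarity
  and Duhamel's integral formula in what follows.\<close>

lemma schroedinger_bound:
  assumes A: "hermitian_mat n A"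
    and carrier: "\<And>s. r s \<in> carrier_vec n" "\<And>s. f s \<in> carrier_vec n"
    and deriv: "\<And>s i. i < n \<Longrightarrow>
      ((\<lambda>s. r s $ i) has_vector_derivative ((- \<i>) \<cdot>\<^sub>v (A *\<^sub>v r s) + f s) $ i) (at s)"
    and f: "\<And>s. 0 \<le> s \<Longrightarrow> s \<le> t \<Longrightarrow> cvnorm (f s) \<le> b s"
    and B: "\<And>s. (B has_real_derivative b s) (at s)"
    and t: "0 \<le> t"
  shows "cvnorm (r t) \<le> cvnorm (r 0) + (B t - B 0)"
proof (rule norm_le_integral_bound[OF carrier(1) _ deriv])
  have Ar: "A *\<^sub>v r s \<in> carrier_vec n" for s
    using hermitian_mat_carrier[OF A] carrier by auto
  then show "(- \<i>) \<cdot>\<^sub>v (A *\<^sub>v r s) + f s \<in> carrier_vec n" for s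
    using carrier by auto
  fix s :: real assume s: "0 \<le> s" "s \<le> t"
  show "0 \<le> b s"
    using f[OF s] cvnorm_nonneg[of "f s"] by linarith
  have "Re (cinner (r s) ((- \<i>) \<cdot>\<^sub>v (A *\<^sub>v r s) + f s)) = Re (cinner (r s) (f s))"
    using Ar[of s] carrier(2)[of s] Im_cinner_hermitian[OF A carrier(1)[of s]]
    by (subst cinner_add_right[of _ n]) (auto simp: cinner_smult_right)
  also have "\<dots> \<le> cvnorm (r s) * cvnorm (f s)"
    using cmod_cinner_le[OF carrier, of s s] complex_Re_le_cmod order_trans by blast
  also have "\<dots> \<le> cvnorm (r s) * b s"
    using f[OF s] by (intro mult_left_mono) auto
  finally show "Re (cinner (r s) ((- \<i>) \<cdot>\<^sub>v (A *\<^sub>v r s) + f s)) \<le> cvnorm (r s) * b s" .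
qed (use B t in auto)

section \<open>The matrix exponential\<close>

lemma pow_mat_smult:
  assumes "A \<in> carrier_mat n n"
  shows "(c \<cdot>\<^sub>m A) ^\<^sub>m k = (c ^ k :: 'a :: comm_semiring_1) \<cdot>\<^sub>m (A ^\<^sub>m k)"
proof (induction k)
  case 0
  then show ?case using assms by auto
next
  case (Suc k)
  have Ak: "A ^\<^sub>m k \<in> carrier_mat n n"
    using assms by (rule pow_carrier_mat)
  have "(c \<cdot>\<^sub>m A) ^\<^sub>m Suc k = (c ^ k \<cdot>\<^sub>m (A ^\<^sub>m k)) * (c \<cdot>\<^sub>m A)"
    using Suc by simp
  also have "\<dots> = c ^ Suc k \<cdot>\<^sub>m (A ^\<^sub>m Suc k)"
    using Ak assms
    by (intro eq_matI)
      (auto simp: scalar_prod_def sum_distrib_left mult_ac)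
  finally show ?case .
qed

lemma pow_mat_Suc_left:
  assumes A: "(A :: 'a :: comm_semiring_1 mat) \<in> carrier_mat n n"
  shows "A ^\<^sub>m Suc k = A * A ^\<^sub>m k"
proof (induction k)
  case 0
  then show ?case using A by simp
next
  case (Suc k)
  have "A ^\<^sub>m Suc (Suc k) = (A * A ^\<^sub>m k) * A"
    using Suc by simp
  also have "\<dots> = A * A ^\<^sub>m Suc k"
    using assoc_mult_mat[OF A pow_carrier_mat[OF A] A, of k] by simp
  finally show ?case .
qed

lemma mult_mat_index:
  assumes "A \<in> carrier_mat m n" "B \<in> carrier_mat n k" "i < m" "j < k"
  shows "(A * B) $$ (i,j) = (\<Sum>l<n. A $$ (i,l) * B $$ (l,j))"
  using assms by (simp add: scalar_prod_def atLeast0LessThan)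

text \<open>Each further factor sums \<open>n\<close> products, hence contributes
  \<open>n * c\<close>. The bound is crude, but the factorials of the exponential series absorb
  it.\<close>

lemma cmod_pow_mat_le:
  assumes A: "(A :: complex mat) \<in> carrier_mat n n" and c: "\<And>i j. i < n \<Longrightarrow> j < n \<Longrightarrow> cmod (A $$ (i,j)) \<le> c"
    and ij: "i < n" "j < n"
  shows "cmod ((A ^\<^sub>m k) $$ (i,j)) \<le> (real n * c) ^ k"
  using ij
proof (induction k arbitrary: i j)
  case 0
  then show ?case using A by auto
next
  case (Suc k)
  have c0: "0 \<le> c"
    using c[OF Suc.prems] norm_ge_zero order_trans by blast
  have "cmod ((A ^\<^sub>m Suc k) $$ (i,j)) = cmod (\<Sum>l<n. (A ^\<^sub>m k) $$ (i,l) * A $$ (l,j))"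
    using Suc.prems A by (simp add: mult_mat_index[OF pow_carrier_mat[OF A] A] del: index_mult_mat(1))
  also have "\<dots> \<le> (\<Sum>l<n. (real n * c) ^ k * c)"
    using Suc c c0 by (intro sum_norm_le) (auto simp: norm_mult intro!: mult_mono)
  finally show ?case by (simp add: mult_ac)
qed

text \<open>The scalar \<open>z\<close> is kept apart from \<open>A\<close>, so that each entry of
  the exponential is an everywhere convergent power series in \<open>z\<close> and can be
  differentiated termwise. The comparison series is the scalar exponential at
  \<open>n * c * cmod z\<close>.\<close>

lemma summable_mat_exp:
  assumes A: "(A :: complex mat) \<in> carrier_mat n n" and ij: "i < n" "j < n"
  shows "summable (\<lambda>k. (A ^\<^sub>m k) $$ (i,j) / of_nat (fact k) * z ^ k)"
proof -
  define c where "c = (\<Sum>i<n. \<Sum>j<n. cmod (A $$ (i,j)))"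
  have c: "cmod (A $$ (i,j)) \<le> c" if "i < n" "j < n" for i j
  proof -
    have "cmod (A $$ (i,j)) \<le> (\<Sum>j<n. cmod (A $$ (i,j)))"
      using that by (intro member_le_sum) auto
    also have "\<dots> \<le> c"
      unfolding c_def using that
      by (intro member_le_sum[of i _ "\<lambda>i. \<Sum>j<n. cmod (A $$ (i,j))"]) (auto intro: sum_nonneg)
    finally show ?thesis .
  qed
  show ?thesis
  proof (rule summable_comparison_test')
    show "summable (\<lambda>k. inverse (fact k) * (real n * c * cmod z) ^ k)"
      by (rule summable_exp)
    fix k
    have "norm ((A ^\<^sub>m k) $$ (i,j) / of_nat (fact k) * z ^ k)
        = cmod ((A ^\<^sub>m k) $$ (i,j)) * (inverse (fact k) * cmod z ^ k)"
      by (simp add: norm_mult norm_divide norm_power divide_inverse norm_inverse norm_fact)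
    also have "\<dots> \<le> (real n * c) ^ k * (inverse (fact k) * cmod z ^ k)"
      by (intro mult_right_mono cmod_pow_mat_le[OF A c ij]) auto
    finally show "norm ((A ^\<^sub>m k) $$ (i,j) / of_nat (fact k) * z ^ k)
        \<le> inverse (fact k) * (real n * c * cmod z) ^ k"
      by (simp add: power_mult_distrib mult_ac)
  qed
qed

lemma mat_exp_carrier: "A \<in> carrier_mat n n \<Longrightarrow> mat_exp A \<in> carrier_mat n n"
  by (auto simp: mat_exp_def)

lemma mat_exp_smult_index:
  assumes A: "A \<in> carrier_mat n n" and ij: "i < n" "j < n"
  shows "mat_exp (z \<cdot>\<^sub>m A) $$ (i,j) = (\<Sum>k. (A ^\<^sub>m k) $$ (i,j) / of_nat (fact k) * z ^ k)"
  using assms pow_carrier_mat[OF A]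
  by (simp add: mat_exp_def pow_mat_smult[OF A] mult.commute)

text \<open>After termwise differentiation the k-th coefficient is the power
  \<open>A ^\<^sub>m Suc k\<close> over \<open>fact k\<close>. Pulling one factor \<open>A\<close>
  out on the left gives back the original series.\<close>

lemma mat_exp_has_field_derivative:
  assumes A: "A \<in> carrier_mat n n" and ij: "i < n" "j < n"
  shows "((\<lambda>z. mat_exp (z \<cdot>\<^sub>m A) $$ (i,j)) has_field_derivative
    (A * mat_exp (z \<cdot>\<^sub>m A)) $$ (i,j)) (at z)"
proof -
  define a where "a i j k = (A ^\<^sub>m k) $$ (i,j) / of_nat (fact k)" for i j k
  have "((\<lambda>z. \<Sum>k. a i j k * z ^ k) has_field_derivative (\<Sum>k. diffs (a i j) k * z ^ k)) (at z)"
    using summable_mat_exp[OF A ij] by (intro termdiffs_strong_converges_everywhere) (simp add: a_def)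
  also have "(\<lambda>z. \<Sum>k. a i j k * z ^ k) = (\<lambda>z. mat_exp (z \<cdot>\<^sub>m A) $$ (i,j))"
    using mat_exp_smult_index[OF A ij] by (simp add: a_def)
  also have "(\<Sum>k. diffs (a i j) k * z ^ k) = (\<Sum>k. \<Sum>l<n. A $$ (i,l) * (a l j k * z ^ k))"
  proof (intro suminf_cong)
    fix k
    have "of_nat (fact (Suc k)) = (of_nat (Suc k) * of_nat (fact k) :: complex)"
      by (simp only: fact_Suc of_nat_mult of_nat_id)
    then have "diffs (a i j) k = (A ^\<^sub>m Suc k) $$ (i,j) / of_nat (fact k)"
      by (simp add: diffs_def a_def del: pow_mat.simps of_nat_Suc fact_Suc of_nat_fact)
    also have "\<dots> = (\<Sum>l<n. A $$ (i,l) * a l j k)"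
      unfolding pow_mat_Suc_left[OF A] using mult_mat_index[OF A pow_carrier_mat[OF A] ij]
      by (simp add: a_def sum_divide_distrib)
    finally show "diffs (a i j) k * z ^ k = (\<Sum>l<n. A $$ (i,l) * (a l j k * z ^ k))"
      by (simp only: sum_distrib_right mult.assoc)
  qed
  also have "\<dots> = (\<Sum>l<n. A $$ (i,l) * (\<Sum>k. a l j k * z ^ k))"
  proof -
    have "summable (\<lambda>k. a l j k * z ^ k)" if "l < n" for l
      unfolding a_def using that ij(2) by (rule summable_mat_exp[OF A])
    then show ?thesis
      by (subst suminf_sum) (auto intro!: summable_mult suminf_mult sum.cong)
  qed
  also have "\<dots> = (A * mat_exp (z \<cdot>\<^sub>m A)) $$ (i,j)"
    using mult_mat_index[OF A mat_exp_carrier ij, of "z \<cdot>\<^sub>m A"] A mat_exp_smult_index[OF A _ ij(2)]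
    by (simp add: a_def)
  finally show ?thesis .
qed

section \<open>Time evolution of vectors\<close>

text \<open>For Hermitian \<open>A\<close> this is the Schroedinger evolution of the initial state
  \<open>w\<close>, i.e. the solution of \<open>u' = -i A u\<close> with
  \<open>u 0 = w\<close>.\<close>

definition evolve :: "complex mat \<Rightarrow> complex vec \<Rightarrow> real \<Rightarrow> complex vec" where
  "evolve A w s = mat_exp ((- \<i> * of_real s) \<cdot>\<^sub>m A) *\<^sub>v w"

lemma evolve_carrier [simp]:
  "A \<in> carrier_mat n n \<Longrightarrow> evolve A w s \<in> carrier_vec n"
  by (intro carrier_vecI) (simp add: evolve_def mat_exp_def)

lemma mat_exp_0:
  assumes "A \<in> carrier_mat n n"
  shows "mat_exp (0 \<cdot>\<^sub>m A) = 1\<^sub>m n"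
proof (rule eq_matI)
  fix i j assume "i < dim_row (1\<^sub>m n :: complex mat)" "j < dim_col (1\<^sub>m n :: complex mat)"
  then show "mat_exp (0 \<cdot>\<^sub>m A) $$ (i,j) = 1\<^sub>m n $$ (i,j)"
    using assms mat_exp_smult_index[of A n i j 0]
      powser_zero[of "\<lambda>k. (A ^\<^sub>m k) $$ (i,j) / of_nat (fact k)"] by simp
qed (use assms in \<open>auto simp: mat_exp_def\<close>)

lemma evolve_0:
  assumes "A \<in> carrier_mat n n" "w \<in> carrier_vec n"
  shows "evolve A w 0 = w"
  using assms by (simp add: evolve_def mat_exp_0)

text \<open>Chain rule for the entrywise complex derivative along the line
  \<open>z = -i s\<close>.\<close>

lemma evolve_has_vector_derivative:
  assumes A: "A \<in> carrier_mat n n" and w: "w \<in> carrier_vec n" and i: "i < n"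
  shows "((\<lambda>s. evolve A w s $ i) has_vector_derivative ((- \<i>) \<cdot>\<^sub>v (A *\<^sub>v evolve A w s)) $ i) (at s)"
proof -
  let ?E = "\<lambda>s. mat_exp ((- \<i> * of_real s) \<cdot>\<^sub>m A)"
  have E: "?E s \<in> carrier_mat n n" for s
    using A by (intro mat_exp_carrier) auto
  have index: "evolve A w s $ i = (\<Sum>j<n. ?E s $$ (i,j) * w $ j)" for s
    unfolding evolve_def by (rule mult_mat_vec_index[OF E w i])
  have "((\<lambda>s. ?E s $$ (i,j)) has_vector_derivative (- \<i>) * (A * ?E s) $$ (i,j)) (at s)"
    if j: "j < n" for j
  proof -
    have "((\<lambda>s. - \<i> * of_real s) has_vector_derivative - \<i>) (at s)"
      by (auto intro!: derivative_eq_intros)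
    from field_vector_diff_chain_at[OF this mat_exp_has_field_derivative[OF A i j]]
    show ?thesis by (simp add: o_def)
  qed
  then have "((\<lambda>s. evolve A w s $ i) has_vector_derivative
      (\<Sum>j<n. (- \<i>) * (A * ?E s) $$ (i,j) * w $ j)) (at s)"
    unfolding index by (intro has_vector_derivative_sum has_vector_derivative_mult_left) auto
  also have "(\<Sum>j<n. (- \<i>) * (A * ?E s) $$ (i,j) * w $ j) = (- \<i>) * ((A * ?E s) *\<^sub>v w) $ i"
    using mult_mat_vec_index[OF mult_carrier_mat[OF A E] w i] by (simp add: sum_distrib_left mult_ac)
  also have "\<dots> = ((- \<i>) \<cdot>\<^sub>v (A *\<^sub>v evolve A w s)) $ i"
    unfolding evolve_def assoc_mult_mat_vec[OF A E w]
    using A i by (simp del: index_mult_mat_vec(1))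
  finally show ?thesis .
qed

section \<open>Decomposition of density matrices\<close>

text \<open>Cholesky factorisation by induction on the size: the last column, scaled by the root of
  the pivot \<open>a\<close>, gives one factor \<open>u\<close>, and subtracting its rank-one part
  leaves the Schur complement on the first \<open>n\<close> indices, again positive semidefinite.
  Functions in place of matrices make passing to the leading block free.\<close>

lemma psd_decomposition:
  fixes p :: "nat \<Rightarrow> nat \<Rightarrow> complex"
  assumes "\<And>i j. i < n \<Longrightarrow> j < n \<Longrightarrow> p j i = cnj (p i j)"
    and "\<And>v. 0 \<le> Re (\<Sum>i<n. \<Sum>j<n. cnj (v i) * p i j * v j)"
  shows "\<exists>w. \<forall>i<n. \<forall>j<n. p i j = (\<Sum>k<n. w k i * cnj (w k j))"
  using assms
proof (induction n arbitrary: p)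
  case 0
  then show ?case by simp
next
  case (Suc n)
  define a where "a = Re (p n n)"
  define T where "T v = (\<Sum>i<n. \<Sum>j<n. cnj (v i) * p i j * v j)" for v
  define S where "S v = Re (T v)" for v
  define b where "b v = (\<Sum>j<n. p n j * v j)" for v
  have pnn: "p n n = of_real a"
    using Suc.prems(1)[of n n] by (simp add: a_def complex_eq_iff)
  have pin: "p i n = cnj (p n i)" if "i < n" for i
    using Suc.prems(1)[of n i] that by simp
  \<comment> \<open>The form evaluated at \<open>v\<close> extended by a last coordinate
    \<open>z\<close>. All that follows comes from suitable choices of \<open>z\<close>.\<close>
  have key: "0 \<le> S v + 2 * Re (cnj (b v) * z) + a * (cmod z)\<^sup>2" for v z
  proof -
    let ?v = "v(n := z)"
    have "(\<Sum>i<Suc n. \<Sum>j<Suc n. cnj (?v i) * p i j * ?v j)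
        = (\<Sum>i<n. (\<Sum>j<n. cnj (v i) * p i j * v j) + cnj (p n i * v i) * z)
          + (\<Sum>j<n. cnj z * (p n j * v j)) + p n n * (z * cnj z)"
      by (simp add: pin mult_ac)
    also have "\<dots> = T v + cnj (b v) * z + cnj (cnj (b v) * z)
          + of_real (a * (cmod z)\<^sup>2)"
      by (simp add: T_def b_def sum.distrib sum_distrib_left sum_distrib_right pnn mult_ac
          complex_norm_square[symmetric] del: complex_cnj_mult)
         (simp add: sum_distrib_left mult_ac)
    finally show ?thesis
      using Suc.prems(2)[of ?v] by (simp only:) (simp add: S_def algebra_simps)
  qed
  have a: "0 \<le> a"
    using key[of "\<lambda>_. 0" 1] by (simp add: S_def T_def b_def)
  have b0: "b v = 0" if "a = 0" for v
  proof (rule ccontr)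
    assume "b v \<noteq> 0"
    then have pos: "0 < (cmod (b v))\<^sup>2"
      by simp
    \<comment> \<open>For zero pivot the form is affine in \<open>z\<close>, so moving far enough
      against \<open>b v\<close> makes it negative. This \<open>c\<close> yields
      \<open>- S v - 2\<close>, impossible as \<open>S v\<close> is nonnegative.\<close>
    define c where "c = (S v + 1) / (cmod (b v))\<^sup>2"
    have "cnj (b v) * (- of_real c * b v) = - of_real (c * (cmod (b v))\<^sup>2)"
      using complex_norm_square[of "b v"] by (simp add: mult_ac)
    then have "Re (cnj (b v) * (- of_real c * b v)) = - (c * (cmod (b v))\<^sup>2)"
      by (simp only: uminus_complex.sel Re_complex_of_real)
    also have "\<dots> = - (S v + 1)"
      using pos by (simp add: c_def)
    finally have "0 \<le> S v - 2 * (S v + 1)"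
      using key[of v "- of_real c * b v"] that by simp
    moreover have "0 \<le> S v"
      using key[of v 0] by simp
    ultimately show False
      by simp
  qed
  have p0: "p n i = 0" if "a = 0" "i < n" for i
    using b0[OF that(1), of "\<lambda>j. if j = i then 1 else 0"] that(2) by (simp add: b_def if_distrib cong: if_cong)
  \<comment> \<open>For \<open>a = 0\<close> division by zero makes \<open>u\<close> vanish, which
    is consistent because the whole last column is then zero.\<close>
  define u where "u i = p i n / of_real (sqrt a)" for i
  have uu: "u i * cnj (u j) = p i n * p n j / of_real a" if "i < n" "j < n" for i j
    using a pin[OF that(2)] by (simp add: u_def flip: of_real_mult)
  have "\<exists>w. \<forall>i<n. \<forall>j<n. p i j - u i * cnj (u j) = (\<Sum>k<n. w k i * cnj (w k j))"
  proof (rule Suc.IH)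
    fix i j assume "i < n" "j < n"
    then show "p j i - u j * cnj (u i) = cnj (p i j - u i * cnj (u j))"
      using Suc.prems(1)[of i j] by (simp add: mult.commute)
  next
    fix v
    have "(\<Sum>i<n. \<Sum>j<n. cnj (v i) * (p i j - u i * cnj (u j)) * v j)
        = T v
          - (\<Sum>i<n. \<Sum>j<n. cnj (p n i * v i) * (p n j * v j) / of_real a)"
      by (simp add: T_def uu pin right_diff_distrib left_diff_distrib sum_subtractf mult_ac)
    also have "(\<Sum>i<n. \<Sum>j<n. cnj (p n i * v i) * (p n j * v j) / of_real a)
        = cnj (b v) * b v / of_real a"
      by (simp only: b_def cnj_sum sum_product sum_divide_distrib)
    also have "\<dots> = of_real ((cmod (b v))\<^sup>2 / a)"
      by (simp add: mult.commute flip: complex_norm_square)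
    finally have eq: "Re (\<Sum>i<n. \<Sum>j<n. cnj (v i) * (p i j - u i * cnj (u j)) * v j)
        = S v - (cmod (b v))\<^sup>2 / a"
      by (simp add: S_def)
    show "0 \<le> Re (\<Sum>i<n. \<Sum>j<n. cnj (v i) * (p i j - u i * cnj (u j)) * v j)"
    proof (cases "a = 0")
      case True
      then show ?thesis unfolding eq using key[of v 0] by simp
    next
      case False
      \<comment> \<open>The choice \<open>z = - b v / a\<close> minimises the form, and the minimum
        is exactly the Schur complement at \<open>v\<close>.\<close>
      have "cnj (b v) * (- b v / of_real a) = - of_real ((cmod (b v))\<^sup>2 / a)"
        using complex_norm_square[of "b v"] by (simp add: mult_ac)
      then have "Re (cnj (b v) * (- b v / of_real a)) = - ((cmod (b v))\<^sup>2 / a)"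
        by (simp only: uminus_complex.sel Re_complex_of_real)
      moreover have "a * (cmod (- b v / of_real a))\<^sup>2 = (cmod (b v))\<^sup>2 / a"
        using False a by (simp add: norm_divide power_divide power2_eq_square)
      ultimately show ?thesis
        unfolding eq using key[of v "- b v / of_real a"] by linarith
    qed
  qed
  then obtain w where w: "\<And>i j. i < n \<Longrightarrow> j < n \<Longrightarrow>
      p i j - u i * cnj (u j) = (\<Sum>k<n. w k i * cnj (w k j))"
    by blast
  \<comment> \<open>The factors from the induction are extended by 0 in coordinate \<open>n\<close>;
    \<open>u\<close> becomes the factor with index \<open>n\<close>.\<close>
  define w' where "w' k i = (if k = n then u i else if i = n then 0 else w k i)" for k i
  have un: "u n = of_real (sqrt a)"
    using a by (simp add: u_def pnn real_div_sqrt flip: of_real_divide)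
  have uin: "u i * of_real (sqrt a) = p i n" if "i < n" for i
    using p0[OF _ that] pin[OF that] a by (cases "a = 0") (auto simp: u_def)
  have "p i j = (\<Sum>k<Suc n. w' k i * cnj (w' k j))" if ij: "i < Suc n" "j < Suc n" for i j
  proof -
    consider "i < n" "j < n" | "i < n" "j = n" | "i = n" "j < n" | "i = n" "j = n"
      using ij by linarith
    then show ?thesis
    proof cases
      case 1
      have "(\<Sum>k<n. w' k i * cnj (w' k j)) = (\<Sum>k<n. w k i * cnj (w k j))"
        using 1 by (intro sum.cong) (auto simp: w'_def)
      then show ?thesis using w[OF 1] by (simp add: w'_def algebra_simps)
    next
      case 2
      then show ?thesis using uin[of i] by (simp add: w'_def un)
    next
      case 3
      have "p n j = cnj (u j * of_real (sqrt a))"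
        using uin[of j] pin[of j] 3 by simp
      then show ?thesis using 3 by (simp add: w'_def un mult.commute)
    next
      case 4
      then show ?thesis using a by (simp add: w'_def un pnn flip: of_real_mult)
    qed
  qed
  then show ?case by blast
qed

text \<open>The factors of the Cholesky decomposition serve as unnormalised pure states. Exchanging
  sums turns the trace into expectation values, and the squared norms are weights that add up to the
  trace of \<rho>.\<close>

lemma density_matrix_decomposition:
  assumes \<rho>: "density_matrix n \<rho>"
  obtains w where "\<And>k. w k \<in> carrier_vec n" "(\<Sum>k<n. (cvnorm (w k))\<^sup>2) = 1"
    and "\<And>X. X \<in> carrier_mat n n \<Longrightarrow> mtrace (\<rho> * X) = (\<Sum>k<n. cinner (w k) (X *\<^sub>v w k))"
proof -
  have carrier: "\<rho> \<in> carrier_mat n n" and adj: "adj \<rho> = \<rho>" and tr: "mtrace \<rho> = 1"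
    and psd: "\<And>v. v \<in> carrier_vec n \<Longrightarrow> 0 \<le> Re (\<Sum>i<n. cnj (v $ i) * (\<rho> *\<^sub>v v) $ i)"
    using \<rho> by (auto simp: density_matrix_def hermitian_mat_def)
  have "\<exists>w. \<forall>i<n. \<forall>j<n. \<rho> $$ (i,j) = (\<Sum>k<n. w k i * cnj (w k j))"
  proof (rule psd_decomposition)
    fix i j assume "i < n" "j < n"
    then show "\<rho> $$ (j,i) = cnj (\<rho> $$ (i,j))"
      using carrier arg_cong[OF adj, of "\<lambda>A. A $$ (j,i)"] by (simp add: adj_def)
  next
    fix v :: "nat \<Rightarrow> complex"
    have "(\<Sum>i<n. cnj (vec n v $ i) * (\<rho> *\<^sub>v vec n v) $ i)
        = (\<Sum>i<n. \<Sum>j<n. cnj (v i) * \<rho> $$ (i,j) * v j)"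
      using mult_mat_vec_index[OF carrier, of "vec n v"]
      by (simp add: sum_distrib_left mult_ac del: index_mult_mat_vec(1))
    then show "0 \<le> Re (\<Sum>i<n. \<Sum>j<n. cnj (v i) * \<rho> $$ (i,j) * v j)"
      using psd[of "vec n v"] by simp
  qed
  then obtain w0 where w0: "\<And>i j. i < n \<Longrightarrow> j < n \<Longrightarrow> \<rho> $$ (i,j) = (\<Sum>k<n. w0 k i * cnj (w0 k j))"
    by blast
  define w where "w k = vec n (w0 k)" for k
  have trace: "mtrace (\<rho> * X) = (\<Sum>k<n. cinner (w k) (X *\<^sub>v w k))" if X: "X \<in> carrier_mat n n" for X
  proof -
    have "mtrace (\<rho> * X) = (\<Sum>i<n. \<Sum>j<n. \<Sum>k<n. w0 k i * cnj (w0 k j) * X $$ (j,i))"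
      using carrier X by (simp add: mtrace_def mult_mat_index[OF carrier X] w0 sum_distrib_right
          del: index_mult_mat(1))
    also have "\<dots> = (\<Sum>j<n. \<Sum>k<n. \<Sum>i<n. w0 k i * cnj (w0 k j) * X $$ (j,i))"
      by (subst sum.swap) (intro sum.cong refl sum.swap)
    also have "\<dots> = (\<Sum>k<n. \<Sum>j<n. \<Sum>i<n. w0 k i * cnj (w0 k j) * X $$ (j,i))"
      by (rule sum.swap)
    also have "\<dots> = (\<Sum>k<n. cinner (w k) (X *\<^sub>v w k))"
      using X mult_mat_vec_index[OF X]
      by (simp add: cinner_def w_def sum_distrib_left mult_ac del: index_mult_mat_vec(1))
    finally show ?thesis .
  qed
  \<comment> \<open>The trace formula at the identity matrix.\<close>
  have "complex_of_real (\<Sum>k<n. (cvnorm (w k))\<^sup>2) = (\<Sum>k<n. cinner (w k) (1\<^sub>m n *\<^sub>v w k))"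
    unfolding of_real_sum by (intro sum.cong refl) (simp add: w_def cinner_self)
  also have "\<dots> = 1"
    using trace[of "1\<^sub>m n"] carrier tr by simp
  finally have "(\<Sum>k<n. (cvnorm (w k))\<^sup>2) = 1"
    using of_real_eq_1_iff by blast
  with trace show ?thesis
    by (intro that[of w]) (auto simp: w_def)
qed

section \<open>Perturbation expansion of expectation values\<close>

lemma mult_mat_vec_diff_index:
  assumes "A \<in> carrier_mat m n" "(u :: 'a :: comm_ring_1 vec) \<in> carrier_vec n" "v \<in> carrier_vec n" "i < m"
  shows "(A *\<^sub>v (u - v)) $ i = (A *\<^sub>v u) $ i - (A *\<^sub>v v) $ i"
  using assms by (simp add: mult_minus_distrib_mat_vec[OF assms(1-3)] del: index_mult_mat_vec(1))

lemma add_smult_mat_mult_vec_index: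
  assumes "A \<in> carrier_mat m n" "V \<in> carrier_mat m n" "(u :: 'a :: comm_ring_1 vec) \<in> carrier_vec n" "i < m"
  shows "((A + c \<cdot>\<^sub>m V) *\<^sub>v u) $ i = (A *\<^sub>v u) $ i + c * (V *\<^sub>v u) $ i"
  using assms by (simp add: scalar_prod_def sum.distrib sum_distrib_left algebra_simps)

text \<open>The difference of two solutions solves the same equation with zero source and zero
  initial value, so the energy estimate forces it to vanish.\<close>

lemma evolve_unique:
  assumes A: "hermitian_mat n A" and u: "\<And>s. u s \<in> carrier_vec n"
    and deriv: "\<And>s i. i < n \<Longrightarrow>
      ((\<lambda>s. u s $ i) has_vector_derivative ((- \<i>) \<cdot>\<^sub>v (A *\<^sub>v u s)) $ i) (at s)"
    and t: "0 \<le> t"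
  shows "u t = evolve A (u 0) t"
proof -
  note A' [simp] = hermitian_mat_carrier[OF A]
  let ?e = "evolve A (u 0)"
  note e = carrier_vecD[OF evolve_carrier[OF A', of "u 0"]]
  have "cvnorm (u t - ?e t) \<le> cvnorm (u 0 - ?e 0) + (0 - 0)"
  proof (rule schroedinger_bound[OF A, where r = "\<lambda>s. u s - ?e s" and f = "\<lambda>_. 0\<^sub>v n" and b = "\<lambda>_. 0"])
    fix s i assume i: "i < n"
    have "((\<lambda>s. u s $ i - ?e s $ i) has_vector_derivative
        ((- \<i>) \<cdot>\<^sub>v (A *\<^sub>v u s)) $ i - ((- \<i>) \<cdot>\<^sub>v (A *\<^sub>v ?e s)) $ i) (at s)"
      by (intro has_vector_derivative_diff deriv i evolve_has_vector_derivative[OF A' u i])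
    then show "((\<lambda>s. (u s - ?e s) $ i) has_vector_derivative
        ((- \<i>) \<cdot>\<^sub>v (A *\<^sub>v (u s - ?e s)) + 0\<^sub>v n) $ i) (at s)"
      using i u by (simp add: mult_mat_vec_diff_index[OF A' u evolve_carrier[OF A']] algebra_simps
          carrier_matD[OF A'] e del: index_mult_mat_vec(1))
  qed (use u t in auto)
  then have "cvnorm (u t - ?e t) = 0"
    using evolve_0[OF A' u] u[of 0] by (simp add: order_antisym)
  then have "(u t - ?e t) $ i = 0" if "i < n" for i
    using that by (auto simp: cvnorm_L2_set L2_set_eq_0_iff e)
  then show ?thesis
    using u[of t] by (intro eq_vecI) (auto simp: e)
qed

text \<open>The contraction half of unitarity: the energy estimate with zero source.\<close>

lemma evolve_norm_le:
  assumes A: "hermitian_mat n A" and w: "w \<in> carrier_vec n" and t: "0 \<le> t"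
  shows "cvnorm (evolve A w t) \<le> cvnorm w"
proof -
  note A' = hermitian_mat_carrier[OF A]
  have "cvnorm (evolve A w t) \<le> cvnorm (evolve A w 0) + (0 - 0)"
  proof (rule schroedinger_bound[OF A, where f = "\<lambda>_. 0\<^sub>v n" and b = "\<lambda>_. 0"])
    show "((\<lambda>s. evolve A w s $ i) has_vector_derivative
        ((- \<i>) \<cdot>\<^sub>v (A *\<^sub>v evolve A w s) + 0\<^sub>v n) $ i) (at s)" if "i < n" for s i
      using evolve_has_vector_derivative[OF A' w that, of s] that A' by simp
  qed (use A' t in auto)
  then show ?thesis
    using evolve_0[OF A' w] by simp
qed

text \<open>The off-diagonal block of the exponential of a block triangular matrix is a directional
  derivative of the exponential, which yields the first-order response \<open>\<phi>\<close> without integration.\<close>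

lemma first_order_response:
  assumes A: "A \<in> carrier_mat n n" and V: "V \<in> carrier_mat n n" and w: "w \<in> carrier_vec n"
  obtains \<phi> u where "\<And>s. \<phi> s \<in> carrier_vec n" "\<phi> 0 = 0\<^sub>v n"
    "\<And>s i. i < n \<Longrightarrow> ((\<lambda>s. \<phi> s $ i) has_vector_derivative
       ((- \<i>) \<cdot>\<^sub>v (A *\<^sub>v \<phi> s) + (- \<i>) \<cdot>\<^sub>v (V *\<^sub>v u s)) $ i) (at s)"
    "\<And>s. u s \<in> carrier_vec n" "u 0 = w"
    "\<And>s i. i < n \<Longrightarrow> ((\<lambda>s. u s $ i) has_vector_derivative ((- \<i>) \<cdot>\<^sub>v (A *\<^sub>v u s)) $ i) (at s)"
proof -
  define Z :: "complex mat" where "Z = 0\<^sub>m n n"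
  define B where "B = four_block_mat A V Z A"
  \<comment> \<open>Started at \<open>(0, w)\<close>, the lower half evolves freely and drives the
    upper half through \<open>V\<close>. \<open>B\<close> need not be Hermitian; the derivative of
    \<open>evolve\<close> holds for every square matrix.\<close>
  define \<Psi> where "\<Psi> = evolve B (0\<^sub>v n @\<^sub>v w)"
  define \<phi> where "\<phi> s = vec_first (\<Psi> s) n" for s
  define u where "u s = vec_last (\<Psi> s) n" for s
  have Z: "Z \<in> carrier_mat n n" and B: "B \<in> carrier_mat (n + n) (n + n)"
    and w0: "0\<^sub>v n @\<^sub>v w \<in> carrier_vec (n + n)"
    using A w by (auto simp: Z_def B_def)
  have \<phi>: "\<phi> s \<in> carrier_vec n" and u: "u s \<in> carrier_vec n" for s
    by (auto simp: \<phi>_def u_def)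
  have \<Psi>_carrier: "\<Psi> s \<in> carrier_vec (n + n)" for s
    unfolding \<Psi>_def by (rule evolve_carrier[OF B])
  have \<Psi>: "\<Psi> s = \<phi> s @\<^sub>v u s" for s
    unfolding \<phi>_def u_def by (rule vec_first_last_append[OF \<Psi>_carrier, symmetric])
  have index: "\<phi> s $ i = \<Psi> s $ i" "u s $ i = \<Psi> s $ (n + i)" if "i < n" for s i
    using \<phi>[of s] u[of s] that by (auto simp: \<Psi>)
  have zero: "Z *\<^sub>v \<phi> s = 0\<^sub>v n" for s
    using \<phi>[of s] by (intro eq_vecI) (auto simp: Z_def)
  have B\<Psi>: "B *\<^sub>v \<Psi> s = (A *\<^sub>v \<phi> s + V *\<^sub>v u s) @\<^sub>v (A *\<^sub>v u s)" for s
    unfolding \<Psi> B_def four_block_mat_mult_vec[OF A V Z A \<phi> u]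
    using A u[of s] \<phi>[of s] zero by simp
  have d: "((\<lambda>s. \<Psi> s $ i) has_vector_derivative (- \<i>) * (B *\<^sub>v \<Psi> s) $ i) (at s)"
    if "i < n + n" for i s
    using evolve_has_vector_derivative[OF B w0 that, of s] that B
    by (simp add: \<Psi>_def del: index_mult_mat_vec(1))
  show ?thesis
  proof (rule that[of \<phi> u, OF \<phi> _ _ u])
    have "\<Psi> 0 = 0\<^sub>v n @\<^sub>v w"
      unfolding \<Psi>_def by (rule evolve_0[OF B w0])
    then have *: "\<phi> 0 @\<^sub>v u 0 = 0\<^sub>v n @\<^sub>v w"
      by (simp add: \<Psi>)
    then show "\<phi> 0 = 0\<^sub>v n" "u 0 = w"
      using append_vec_eq[OF \<phi>, of "0\<^sub>v n" 0 "u 0" w] by auto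
  next
    fix s i assume i: "i < n"
    show "((\<lambda>s. \<phi> s $ i) has_vector_derivative
       ((- \<i>) \<cdot>\<^sub>v (A *\<^sub>v \<phi> s) + (- \<i>) \<cdot>\<^sub>v (V *\<^sub>v u s)) $ i) (at s)"
      using d[of i s] i A V unfolding index[OF i] B\<Psi>
      by (simp add: algebra_simps del: index_mult_mat_vec(1))
    show "((\<lambda>s. u s $ i) has_vector_derivative ((- \<i>) \<cdot>\<^sub>v (A *\<^sub>v u s)) $ i) (at s)"
      using d[of "n + i" s] i A V unfolding index[OF i] B\<Psi>
      by (simp del: index_mult_mat_vec(1))
  qed
qed

text \<open>The energy estimate is applied twice. The difference of the evolutions has a source of
  size \<open>\<bar>x\<bar> * cvnorm w\<close>; after removal of the linear response the source is
  of size \<open>x\<^sup>2 * s * cvnorm w\<close>, which integrates to the stated remainder. The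
  vector \<open>\<phi>\<close> is fixed before \<open>x\<close>, so the linear term is genuinely
  linear.\<close>

lemma evolve_second_order:
  assumes A: "hermitian_mat n A" and V: "hermitian_mat n V" "opnorm V \<le> 1"
    and w: "w \<in> carrier_vec n" and t: "0 \<le> t"
  obtains \<phi> where "\<phi> \<in> carrier_vec n"
    "\<And>x. hermitian_mat n (A + complex_of_real x \<cdot>\<^sub>m V) \<Longrightarrow>
       cvnorm (evolve (A + complex_of_real x \<cdot>\<^sub>m V) w t - evolve A w t) \<le> \<bar>x\<bar> * t * cvnorm w"
    "\<And>x. hermitian_mat n (A + complex_of_real x \<cdot>\<^sub>m V) \<Longrightarrow>
       cvnorm (evolve (A + complex_of_real x \<cdot>\<^sub>m V) w t - evolve A w t - complex_of_real x \<cdot>\<^sub>v \<phi>)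
         \<le> x\<^sup>2 * t\<^sup>2 / 2 * cvnorm w"
proof -
  note A' = hermitian_mat_carrier[OF A] and V' = hermitian_mat_carrier[OF V(1)]
  obtain \<phi> u where \<phi>: "\<And>s. \<phi> s \<in> carrier_vec n" "\<phi> 0 = 0\<^sub>v n"
    "\<And>s i. i < n \<Longrightarrow> ((\<lambda>s. \<phi> s $ i) has_vector_derivative
       ((- \<i>) \<cdot>\<^sub>v (A *\<^sub>v \<phi> s) + (- \<i>) \<cdot>\<^sub>v (V *\<^sub>v u s)) $ i) (at s)"
    and u: "\<And>s. u s \<in> carrier_vec n" "u 0 = w"
    "\<And>s i. i < n \<Longrightarrow> ((\<lambda>s. u s $ i) has_vector_derivative ((- \<i>) \<cdot>\<^sub>v (A *\<^sub>v u s)) $ i) (at s)"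
    by (rule first_order_response[OF A' V' w]) (rule that)
  have u_eq: "u s = evolve A w s" if "0 \<le> s" for s
    using evolve_unique[OF A u(1,3) that] u(2) by simp
  have Vle: "cvnorm (V *\<^sub>v v) \<le> cvnorm v" if "v \<in> carrier_vec n" for v
    using cvnorm_mult_mat_vec_le[OF V' that] mult_right_mono[OF V(2) cvnorm_nonneg[of v]] by simp
  have first: "cvnorm (evolve (A + complex_of_real x \<cdot>\<^sub>m V) w s - u s) \<le> \<bar>x\<bar> * s * cvnorm w"
    if B: "hermitian_mat n (A + complex_of_real x \<cdot>\<^sub>m V)" and s: "0 \<le> s" for x s
  proof -
    define B where "B = A + complex_of_real x \<cdot>\<^sub>m V"
    note B' = hermitian_mat_carrier[OF B, folded B_def]
    define v where "v = evolve B w"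
    have v: "v s \<in> carrier_vec n" for s
      unfolding v_def by (rule evolve_carrier[OF B'])
    let ?f = "\<lambda>s. (- \<i> * of_real x) \<cdot>\<^sub>v (V *\<^sub>v u s)"
    have "cvnorm (v s - u s) \<le> cvnorm (v 0 - u 0) + (\<bar>x\<bar> * s * cvnorm w - \<bar>x\<bar> * 0 * cvnorm w)"
    \<comment> \<open>With the perturbed matrix as generator the source is \<open>V\<close> applied
      to the unperturbed solution, whose norm is known.\<close>
    proof (rule schroedinger_bound[OF B[folded B_def], where b = "\<lambda>_. \<bar>x\<bar> * cvnorm w" and f = ?f and r = "\<lambda>s. v s - u s"])
      fix q i assume i: "i < n"
      have "((\<lambda>s. v s $ i - u s $ i) has_vector_derivative
          ((- \<i>) \<cdot>\<^sub>v (B *\<^sub>v v q)) $ i - ((- \<i>) \<cdot>\<^sub>v (A *\<^sub>v u q)) $ i) (at q)"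
        unfolding v_def
        by (intro has_vector_derivative_diff u i evolve_has_vector_derivative[OF B' w i])
      moreover have "((- \<i>) \<cdot>\<^sub>v (B *\<^sub>v v q)) $ i - ((- \<i>) \<cdot>\<^sub>v (A *\<^sub>v u q)) $ i
          = ((- \<i>) \<cdot>\<^sub>v (B *\<^sub>v (v q - u q)) + ?f q) $ i"
        using i carrier_matD[OF A'] carrier_matD[OF V'] v[of q] u(1)[of q]
        by (simp add: B_def add_smult_mat_mult_vec_index[OF A' V'] mult_mat_vec_diff_index[OF A']
            mult_mat_vec_diff_index[OF V'] algebra_simps del: index_mult_mat_vec(1))
      ultimately show "((\<lambda>s. (v s - u s) $ i) has_vector_derivative
          ((- \<i>) \<cdot>\<^sub>v (B *\<^sub>v (v q - u q)) + ?f q) $ i) (at q)"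
        using i v u(1) by (simp add: carrier_vecD[OF u(1)] carrier_vecD[OF v])
    next
      fix q :: real assume q: "0 \<le> q" "q \<le> s"
      have "cvnorm (V *\<^sub>v u q) \<le> cvnorm w"
        using Vle[OF u(1)[of q]] evolve_norm_le[OF A w q(1)] u_eq[OF q(1)] by simp
      then show "cvnorm (?f q) \<le> \<bar>x\<bar> * cvnorm w"
        by (simp add: cvnorm_smult norm_mult mult_left_mono)
    next
      show "((\<lambda>s. \<bar>x\<bar> * s * cvnorm w) has_real_derivative \<bar>x\<bar> * cvnorm w) (at s')" for s'
        by (auto intro!: derivative_eq_intros)
    qed (use v u(1) V' s in auto)
    then show ?thesis
      using evolve_0[OF B' w] w by (simp add: v_def B_def u(2))
  qed
  have second: "cvnorm (evolve (A + complex_of_real x \<cdot>\<^sub>m V) w s - u s - complex_of_real x \<cdot>\<^sub>v \<phi> s)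
      \<le> x\<^sup>2 * s\<^sup>2 / 2 * cvnorm w"
    if B: "hermitian_mat n (A + complex_of_real x \<cdot>\<^sub>m V)" and s: "0 \<le> s" for x s
  proof -
    define B where "B = A + complex_of_real x \<cdot>\<^sub>m V"
    note B' = hermitian_mat_carrier[OF B, folded B_def]
    define v where "v = evolve B w"
    have v: "v s \<in> carrier_vec n" for s
      unfolding v_def by (rule evolve_carrier[OF B'])
    let ?f = "\<lambda>s. (- \<i> * of_real x) \<cdot>\<^sub>v (V *\<^sub>v (v s - u s))"
    let ?r = "\<lambda>s. v s - u s - complex_of_real x \<cdot>\<^sub>v \<phi> s"
    have "cvnorm (?r s) \<le> cvnorm (?r 0) + (x\<^sup>2 * s\<^sup>2 / 2 * cvnorm w - x\<^sup>2 * 0\<^sup>2 / 2 * cvnorm w)"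
    \<comment> \<open>Now the unperturbed matrix is the generator: the source is \<open>V\<close>
      applied to the difference \<open>v - u\<close>, which \<open>first\<close> already
      bounds.\<close>
    proof (rule schroedinger_bound[OF A, where b = "\<lambda>s. x\<^sup>2 * s * cvnorm w" and f = ?f and r = ?r])
      fix q i assume i: "i < n"
      have "((\<lambda>s. v s $ i - u s $ i - complex_of_real x * \<phi> s $ i) has_vector_derivative
          ((- \<i>) \<cdot>\<^sub>v (B *\<^sub>v v q)) $ i - ((- \<i>) \<cdot>\<^sub>v (A *\<^sub>v u q)) $ i
          - complex_of_real x * ((- \<i>) \<cdot>\<^sub>v (A *\<^sub>v \<phi> q) + (- \<i>) \<cdot>\<^sub>v (V *\<^sub>v u q)) $ i) (at q)"
        unfolding v_def
        by (intro has_vector_derivative_diff has_vector_derivative_mult_right u \<phi> i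
            evolve_has_vector_derivative[OF B' w i])
      moreover have "((- \<i>) \<cdot>\<^sub>v (B *\<^sub>v v q)) $ i - ((- \<i>) \<cdot>\<^sub>v (A *\<^sub>v u q)) $ i
          - complex_of_real x * ((- \<i>) \<cdot>\<^sub>v (A *\<^sub>v \<phi> q) + (- \<i>) \<cdot>\<^sub>v (V *\<^sub>v u q)) $ i
          = ((- \<i>) \<cdot>\<^sub>v (A *\<^sub>v ?r q) + ?f q) $ i"
        using i carrier_matD[OF A'] carrier_matD[OF V'] v[of q] u(1)[of q] \<phi>(1)[of q]
        by (simp add: B_def add_smult_mat_mult_vec_index[OF A' V'] mult_mat_vec_diff_index[OF A']
            mult_mat_vec_diff_index[OF V'] mult_mat_vec[OF A'] algebra_simps del: index_mult_mat_vec(1))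
      ultimately show "((\<lambda>s. ?r s $ i) has_vector_derivative
          ((- \<i>) \<cdot>\<^sub>v (A *\<^sub>v ?r q) + ?f q) $ i) (at q)"
        using i by (simp add: carrier_vecD[OF u(1)] carrier_vecD[OF v] carrier_vecD[OF \<phi>(1)])
    next
      fix q :: real assume q: "0 \<le> q" "q \<le> s"
      have "cvnorm (V *\<^sub>v (v q - u q)) \<le> \<bar>x\<bar> * q * cvnorm w"
        using Vle[of "v q - u q"] first[OF B q(1)] v[of q] u(1)[of q] by (simp add: v_def B_def)
      then have "\<bar>x\<bar> * cvnorm (V *\<^sub>v (v q - u q)) \<le> \<bar>x\<bar> * (\<bar>x\<bar> * q * cvnorm w)"
        by (rule mult_left_mono) simp
      then show "cvnorm (?f q) \<le> x\<^sup>2 * q * cvnorm w"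
        by (simp add: cvnorm_smult norm_mult power2_eq_square mult.assoc[symmetric] abs_mult_self_eq)
    next
      show "((\<lambda>s. x\<^sup>2 * s\<^sup>2 / 2 * cvnorm w) has_real_derivative x\<^sup>2 * s' * cvnorm w) (at s')" for s'
        by (auto intro!: derivative_eq_intros)
    qed (use v u(1) \<phi>(1) V' s in auto)
    moreover have "?r 0 = 0\<^sub>v n"
      using evolve_0[OF B' w] w by (auto simp: v_def u(2) \<phi>(2))
    ultimately show ?thesis
      by (simp add: v_def B_def)
  qed
  show ?thesis
    using that[of "\<phi> t"] \<phi>(1) first[OF _ t] second[OF _ t] u_eq[OF t] by simp
qed

section \<open>Quadratic forms in evolved vectors\<close>

lemma cinner_quadratic_expansion:
  assumes Ob: "Ob \<in> carrier_mat n n" and "p \<in> carrier_vec n" "d \<in> carrier_vec n"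
  shows "cinner (p + d) (Ob *\<^sub>v (p + d)) =
    cinner p (Ob *\<^sub>v p) + cinner p (Ob *\<^sub>v d) + cinner d (Ob *\<^sub>v p) + cinner d (Ob *\<^sub>v d)"
proof -
  have "Ob *\<^sub>v p \<in> carrier_vec n" "Ob *\<^sub>v d \<in> carrier_vec n"
    using assms by auto
  then show ?thesis
    using assms mult_add_distrib_mat_vec[OF assms]
    by (simp add: cinner_add_right[of _ n] cinner_add_left[of _ n])
qed

lemma cmod_cinner_mult_mat_vec_le:
  assumes Ob: "Ob \<in> carrier_mat n n" and u: "u \<in> carrier_vec n" and v: "v \<in> carrier_vec n"
    and "cvnorm u \<le> a" "cvnorm v \<le> b"
  shows "cmod (cinner u (Ob *\<^sub>v v)) \<le> opnorm Ob * (a * b)"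
proof -
  have "0 \<le> a"
    using assms(4) cvnorm_nonneg order_trans by blast
  have "cmod (cinner u (Ob *\<^sub>v v)) \<le> cvnorm u * cvnorm (Ob *\<^sub>v v)"
    using Ob u v by (intro cmod_cinner_le[of _ n]) auto
  also have "\<dots> \<le> a * (opnorm Ob * b)"
  proof (intro mult_mono)
    show "cvnorm (Ob *\<^sub>v v) \<le> opnorm Ob * b"
      using cvnorm_mult_mat_vec_le[OF Ob v] mult_left_mono[OF assms(5) opnorm_nonneg[OF Ob]] by simp
  qed (use assms \<open>0 \<le> a\<close> in auto)
  finally show ?thesis by (simp add: mult_ac)
qed

text \<open>Writing the perturbed vector as \<open>p + d\<close> with
  \<open>d = x \<phi> + r\<close>, all terms linear in \<open>x\<close> are collected in
  \<open>L\<close>. The constant 2 is 1/2 + 1/2 + 1: two cross terms of \<open>p\<close> with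
  \<open>r\<close>, and the term quadratic in \<open>d\<close>.\<close>

lemma quadratic_form_second_order:
  assumes A: "hermitian_mat n A" and V: "hermitian_mat n V" "opnorm V \<le> 1"
    and Ob: "Ob \<in> carrier_mat n n" and w: "w \<in> carrier_vec n" and t: "0 \<le> t"
  shows "\<exists>L. \<forall>x. hermitian_mat n (A + complex_of_real x \<cdot>\<^sub>m V) \<longrightarrow>
    cmod (cinner (evolve (A + complex_of_real x \<cdot>\<^sub>m V) w t) (Ob *\<^sub>v evolve (A + complex_of_real x \<cdot>\<^sub>m V) w t)
      - cinner (evolve A w t) (Ob *\<^sub>v evolve A w t) - of_real x * L)
    \<le> 2 * x\<^sup>2 * t\<^sup>2 * opnorm Ob * (cvnorm w)\<^sup>2"
proof -
  obtain \<phi> where \<phi>: "\<phi> \<in> carrier_vec n" and first: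
    "\<And>x. hermitian_mat n (A + complex_of_real x \<cdot>\<^sub>m V) \<Longrightarrow>
       cvnorm (evolve (A + complex_of_real x \<cdot>\<^sub>m V) w t - evolve A w t) \<le> \<bar>x\<bar> * t * cvnorm w"
    and second: "\<And>x. hermitian_mat n (A + complex_of_real x \<cdot>\<^sub>m V) \<Longrightarrow>
       cvnorm (evolve (A + complex_of_real x \<cdot>\<^sub>m V) w t - evolve A w t - complex_of_real x \<cdot>\<^sub>v \<phi>)
         \<le> x\<^sup>2 * t\<^sup>2 / 2 * cvnorm w"
    by (rule evolve_second_order[OF A V w t]) (rule that)
  define p where "p = evolve A w t"
  have p: "p \<in> carrier_vec n" "cvnorm p \<le> cvnorm w"
    unfolding p_def using evolve_carrier[OF hermitian_mat_carrier[OF A]] evolve_norm_le[OF A w t] by auto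
  define L where "L = cinner p (Ob *\<^sub>v \<phi>) + cinner \<phi> (Ob *\<^sub>v p)"
  have "cmod (cinner v (Ob *\<^sub>v v) - cinner p (Ob *\<^sub>v p) - of_real x * L)
      \<le> 2 * x\<^sup>2 * t\<^sup>2 * opnorm Ob * (cvnorm w)\<^sup>2"
    if B: "hermitian_mat n (A + complex_of_real x \<cdot>\<^sub>m V)"
      and v_def: "v = evolve (A + complex_of_real x \<cdot>\<^sub>m V) w t" for x v
  proof -
    have v: "v \<in> carrier_vec n"
      unfolding v_def by (rule evolve_carrier[OF hermitian_mat_carrier[OF B]])
    define r where "r = v - p - complex_of_real x \<cdot>\<^sub>v \<phi>"
    define d where "d = v - p"
    have r: "r \<in> carrier_vec n" "cvnorm r \<le> x\<^sup>2 * t\<^sup>2 / 2 * cvnorm w"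
      using second[OF B] v p \<phi> by (auto simp: r_def p_def v_def)
    have d: "d \<in> carrier_vec n" "cvnorm d \<le> \<bar>x\<bar> * t * cvnorm w"
      using first[OF B] v p by (auto simp: d_def p_def v_def)
    have vpd: "v = p + d" and dr: "d = complex_of_real x \<cdot>\<^sub>v \<phi> + r"
      using v p \<phi> by (auto simp: d_def r_def)
    have "cinner v (Ob *\<^sub>v v) - cinner p (Ob *\<^sub>v p)
        = cinner p (Ob *\<^sub>v d) + cinner d (Ob *\<^sub>v p) + cinner d (Ob *\<^sub>v d)"
      unfolding vpd using cinner_quadratic_expansion[OF Ob p(1) d(1)] by simp
    moreover have "cinner p (Ob *\<^sub>v d) = of_real x * cinner p (Ob *\<^sub>v \<phi>) + cinner p (Ob *\<^sub>v r)"
      unfolding dr using Ob p(1) \<phi> r(1) mult_mat_vec_carrier[OF Ob \<phi>] mult_mat_vec_carrier[OF Ob r(1)]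
      by (simp add: mult_add_distrib_mat_vec[OF Ob] cinner_add_right[of _ n] cinner_smult_right
          mult_mat_vec[OF Ob])
    moreover have "cinner d (Ob *\<^sub>v p) = of_real x * cinner \<phi> (Ob *\<^sub>v p) + cinner r (Ob *\<^sub>v p)"
      unfolding dr using Ob p(1) \<phi> r(1) mult_mat_vec_carrier[OF Ob p(1)]
      by (simp add: cinner_add_left[of _ n] cinner_smult_left[of _ n])
    ultimately have "cinner v (Ob *\<^sub>v v) - cinner p (Ob *\<^sub>v p) - of_real x * L
        = cinner p (Ob *\<^sub>v r) + cinner r (Ob *\<^sub>v p) + cinner d (Ob *\<^sub>v d)"
      by (simp add: L_def algebra_simps)
    also have "cmod \<dots> \<le> opnorm Ob * (cvnorm w * (x\<^sup>2 * t\<^sup>2 / 2 * cvnorm w))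
        + opnorm Ob * ((x\<^sup>2 * t\<^sup>2 / 2 * cvnorm w) * cvnorm w)
        + opnorm Ob * ((\<bar>x\<bar> * t * cvnorm w) * (\<bar>x\<bar> * t * cvnorm w))"
      by (intro norm_triangle_le add_mono cmod_cinner_mult_mat_vec_le[OF Ob p(1) r(1) p(2) r(2)]
          cmod_cinner_mult_mat_vec_le[OF Ob r(1) p(1) r(2) p(2)]
          cmod_cinner_mult_mat_vec_le[OF Ob d(1) d(1) d(2) d(2)])
    also have "\<dots> = 2 * x\<^sup>2 * t\<^sup>2 * opnorm Ob * (cvnorm w)\<^sup>2"
      by (simp add: power2_eq_square algebra_simps abs_mult_self_eq flip: abs_mult)
    finally show ?thesis .
  qed
  then show ?thesis
    unfolding p_def by blast
qed

section \<open>Adjoint of the exponential and the Heisenberg picture\<close>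

lemma adj_mult:
  assumes A: "A \<in> carrier_mat m n" and B: "B \<in> carrier_mat n k"
  shows "adj (A * B) = adj B * adj A"
proof (rule eq_matI)
  fix i j assume "i < dim_row (adj B * adj A)" "j < dim_col (adj B * adj A)"
  then have ij: "i < k" "j < m"
    using A B by (auto simp: adj_def)
  show "adj (A * B) $$ (i,j) = (adj B * adj A) $$ (i,j)"
    using mult_mat_index[OF A B ij(2,1)] mult_mat_index[OF adj_carrier[OF B] adj_carrier[OF A] ij] ij A B
    by (simp add: adj_def mult.commute del: index_mult_mat(1))
qed (use A B in \<open>auto simp: adj_def\<close>)

lemma hermitian_mat_pow:
  assumes A: "hermitian_mat n A"
  shows "hermitian_mat n (A ^\<^sub>m k)"
proof (induction k)
  case 0
  show ?case
    using hermitian_mat_carrier[OF A] by (auto simp: hermitian_mat_def adj_def intro!: eq_matI)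
next
  case (Suc k)
  note A' = hermitian_mat_carrier[OF A]
  have "adj (A ^\<^sub>m Suc k) = A * A ^\<^sub>m k"
    using A Suc adj_mult[OF pow_carrier_mat[OF A'] A', of k] by (simp add: hermitian_mat_def)
  then show ?case
    unfolding hermitian_mat_def using pow_carrier_mat[OF A', of "Suc k"] pow_mat_Suc_left[OF A', of k] by simp
qed

lemma hermitian_mat_index:
  assumes "hermitian_mat n A" "i < n" "j < n"
  shows "cnj (A $$ (j,i)) = A $$ (i,j)"
proof -
  have "adj A $$ (i,j) = A $$ (i,j)"
    using assms(1) by (simp add: hermitian_mat_def)
  then show ?thesis
    using hermitian_mat_carrier[OF assms(1)] assms(2,3) by (simp add: adj_def)
qed

text \<open>Conjugation passes through the convergent series, and powers of a Hermitian matrix are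
  Hermitian. At \<open>z = i t\<close> this identifies the two exponentials in \<open>heis\<close>
  as adjoints of each other.\<close>

lemma adj_mat_exp:
  assumes A: "hermitian_mat n A"
  shows "adj (mat_exp (z \<cdot>\<^sub>m A)) = mat_exp (cnj z \<cdot>\<^sub>m A)"
proof (rule eq_matI)
  note A' = hermitian_mat_carrier[OF A]
  fix i j assume "i < dim_row (mat_exp (cnj z \<cdot>\<^sub>m A))" "j < dim_col (mat_exp (cnj z \<cdot>\<^sub>m A))"
  then have ij: "i < n" "j < n"
    using A' by (auto simp: mat_exp_def)
  have "cnj (mat_exp (z \<cdot>\<^sub>m A) $$ (j,i)) = (\<Sum>k. cnj ((A ^\<^sub>m k) $$ (j,i) / of_nat (fact k) * z ^ k))"
    unfolding mat_exp_smult_index[OF A' ij(2,1)]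
    by (rule bounded_linear.suminf[OF bounded_linear_cnj summable_mat_exp[OF A' ij(2,1)]])
  also have "\<dots> = mat_exp (cnj z \<cdot>\<^sub>m A) $$ (i,j)"
    unfolding mat_exp_smult_index[OF A' ij]
    by (simp add: hermitian_mat_index[OF hermitian_mat_pow[OF A] ij])
  finally show "adj (mat_exp (z \<cdot>\<^sub>m A)) $$ (i,j) = mat_exp (cnj z \<cdot>\<^sub>m A) $$ (i,j)"
    using ij A' by (simp add: adj_def mat_exp_def)
qed (use hermitian_mat_carrier[OF A] in \<open>auto simp: adj_def mat_exp_def\<close>)

lemma heis_carrier:
  "A \<in> carrier_mat n n \<Longrightarrow> Ob \<in> carrier_mat n n \<Longrightarrow> heis A Ob t \<in> carrier_mat n n"
  unfolding heis_def by (intro mult_carrier_mat[of _ n n] mat_exp_carrier) auto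

text \<open>Moving the left exponential to the other side of the inner product passes from the
  Heisenberg to the Schroedinger picture.\<close>

lemma cinner_heis:
  assumes A: "hermitian_mat n A" and Ob: "Ob \<in> carrier_mat n n" and w: "w \<in> carrier_vec n"
  shows "cinner w (heis A Ob t *\<^sub>v w) = cinner (evolve A w t) (Ob *\<^sub>v evolve A w t)"
proof -
  define P where "P = mat_exp ((\<i> * of_real t) \<cdot>\<^sub>m A)"
  define Q where "Q = mat_exp ((- \<i> * of_real t) \<cdot>\<^sub>m A)"
  have P: "P \<in> carrier_mat n n" and Q: "Q \<in> carrier_mat n n"
    unfolding P_def Q_def using hermitian_mat_carrier[OF A] by (auto intro!: mat_exp_carrier)
  have "adj P = Q"
    unfolding P_def Q_def adj_mat_exp[OF A] by simp
  moreover have "cinner w (heis A Ob t *\<^sub>v w) = cinner w (P *\<^sub>v (Ob *\<^sub>v (Q *\<^sub>v w)))"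
    unfolding heis_def P_def[symmetric] Q_def[symmetric]
    using P Q Ob w assoc_mult_mat_vec[OF mult_carrier_mat[OF P Ob] Q w]
      assoc_mult_mat_vec[OF P Ob mult_mat_vec_carrier[OF Q w]] by simp
  ultimately show ?thesis
    using cinner_mult_mat_vec[OF P w, of "Ob *\<^sub>v (Q *\<^sub>v w)"] P Q Ob w
    by (simp add: evolve_def Q_def)
qed

lemma hermitian_mat_add_smult:
  assumes A: "hermitian_mat n A" and V: "hermitian_mat n V"
  shows "hermitian_mat n (A + complex_of_real x \<cdot>\<^sub>m V)"
  unfolding hermitian_mat_def
  using hermitian_mat_carrier[OF A] hermitian_mat_carrier[OF V]
    hermitian_mat_index[OF A] hermitian_mat_index[OF V]
  by (auto simp: adj_def intro!: eq_matI)

text \<open>A bound uniform in the Hamiltonian; it later supplies integrability over the random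
  couplings.\<close>

lemma cmod_mtrace_heis_le:
  assumes A: "hermitian_mat n A" and Ob: "Ob \<in> carrier_mat n n" and \<rho>: "density_matrix n \<rho>"
    and t: "0 \<le> t"
  shows "cmod (mtrace (\<rho> * heis A Ob t)) \<le> opnorm Ob"
proof -
  obtain w where w: "\<And>k. w k \<in> carrier_vec n" "(\<Sum>k<n. (cvnorm (w k))\<^sup>2) = 1"
    "\<And>X. X \<in> carrier_mat n n \<Longrightarrow> mtrace (\<rho> * X) = (\<Sum>k<n. cinner (w k) (X *\<^sub>v w k))"
    by (rule density_matrix_decomposition[OF \<rho>]) (rule that)
  note A' = hermitian_mat_carrier[OF A]
  have "mtrace (\<rho> * heis A Ob t) = (\<Sum>k<n. cinner (evolve A (w k) t) (Ob *\<^sub>v evolve A (w k) t))"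
    by (simp add: w(3)[OF heis_carrier[OF A' Ob]] cinner_heis[OF A Ob w(1)])
  also have "cmod \<dots> \<le> (\<Sum>k<n. opnorm Ob * (cvnorm (w k) * cvnorm (w k)))"
    by (intro sum_norm_le cmod_cinner_mult_mat_vec_le[OF Ob] evolve_carrier[OF A']
        evolve_norm_le[OF A w(1) t])
  also have "\<dots> = opnorm Ob"
    using w(2) by (simp add: power2_eq_square flip: sum_distrib_left)
  finally show ?thesis .
qed

text \<open>The expansions for the vectors \<open>w k\<close> are summed. Their weights add up to 1,
  so the constant does not depend on the dimension \<open>n\<close>.\<close>

lemma mtrace_heis_second_order:
  assumes A: "hermitian_mat n A" and V: "hermitian_mat n V" "opnorm V \<le> 1"
    and Ob: "Ob \<in> carrier_mat n n" and \<rho>: "density_matrix n \<rho>" and t: "0 \<le> t"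
  shows "\<exists>L. \<forall>x. cmod (mtrace (\<rho> * heis (A + complex_of_real x \<cdot>\<^sub>m V) Ob t)
      - mtrace (\<rho> * heis A Ob t) - of_real x * L) \<le> 2 * t\<^sup>2 * opnorm Ob * x\<^sup>2"
proof -
  obtain w where w: "\<And>k. w k \<in> carrier_vec n" "(\<Sum>k<n. (cvnorm (w k))\<^sup>2) = 1"
    "\<And>X. X \<in> carrier_mat n n \<Longrightarrow> mtrace (\<rho> * X) = (\<Sum>k<n. cinner (w k) (X *\<^sub>v w k))"
    by (rule density_matrix_decomposition[OF \<rho>]) (rule that)
  have trace: "mtrace (\<rho> * heis B Ob t) = (\<Sum>k<n. cinner (evolve B (w k) t) (Ob *\<^sub>v evolve B (w k) t))"
    if "hermitian_mat n B" for B
    by (simp add: w(3)[OF heis_carrier[OF hermitian_mat_carrier[OF that] Ob]]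
        cinner_heis[OF that Ob w(1)])
  obtain L where L: "\<And>k x. cmod (cinner (evolve (A + complex_of_real x \<cdot>\<^sub>m V) (w k) t)
        (Ob *\<^sub>v evolve (A + complex_of_real x \<cdot>\<^sub>m V) (w k) t)
      - cinner (evolve A (w k) t) (Ob *\<^sub>v evolve A (w k) t) - of_real x * L k)
    \<le> 2 * x\<^sup>2 * t\<^sup>2 * opnorm Ob * (cvnorm (w k))\<^sup>2"
    using quadratic_form_second_order[OF A V Ob w(1) t] hermitian_mat_add_smult[OF A V(1)] by metis
  show ?thesis
  proof (intro exI allI)
    fix x :: real
    have "mtrace (\<rho> * heis (A + complex_of_real x \<cdot>\<^sub>m V) Ob t) - mtrace (\<rho> * heis A Ob t)
        - of_real x * (\<Sum>k<n. L k)
      = (\<Sum>k<n. cinner (evolve (A + complex_of_real x \<cdot>\<^sub>m V) (w k) t)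
        (Ob *\<^sub>v evolve (A + complex_of_real x \<cdot>\<^sub>m V) (w k) t)
      - cinner (evolve A (w k) t) (Ob *\<^sub>v evolve A (w k) t) - of_real x * L k)"
      by (simp add: trace A hermitian_mat_add_smult[OF A V(1)] sum_subtractf sum_distrib_left)
    also have "cmod \<dots> \<le> (\<Sum>k<n. 2 * x\<^sup>2 * t\<^sup>2 * opnorm Ob * (cvnorm (w k))\<^sup>2)"
      by (intro sum_norm_le L)
    also have "\<dots> = 2 * t\<^sup>2 * opnorm Ob * x\<^sup>2"
      using w(2) by (simp add: flip: sum_distrib_left)
    finally show "cmod (mtrace (\<rho> * heis (A + complex_of_real x \<cdot>\<^sub>m V) Ob t)
        - mtrace (\<rho> * heis A Ob t) - of_real x * (\<Sum>k<n. L k)) \<le> 2 * t\<^sup>2 * opnorm Ob * x\<^sup>2" .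
  qed
qed

section \<open>Deformed Gaussian variables\<close>

lemma sets_std_normal [measurable_cong, simp]: "sets std_normal = sets borel"
  by (simp add: std_normal_def)

lemma space_std_normal [simp]: "space std_normal = UNIV"
  by (simp add: std_normal_def)

lemma prob_space_std_normal: "prob_space std_normal"
  unfolding std_normal_def by (rule prob_space_normal_density) simp

lemma std_normal_square:
  "integrable std_normal (\<lambda>\<theta>. \<theta>\<^sup>2)" "(\<integral>\<theta>. \<theta>\<^sup>2 \<partial>std_normal) = 1"
  using integrable_std_normal_moment[of 2] integral_std_normal_moment_even[of 1]
  by (auto simp: std_normal_def integrable_density integral_density)

text \<open>Mean value inequality on the whole line, starting from \<open>chi 0 = 0\<close>.\<close>

lemma chi_deformation_abs_le:
  assumes "chi_deformation \<delta> \<Gamma> chi"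
  shows "\<bar>chi \<theta>\<bar> \<le> \<delta> * \<bar>\<theta>\<bar>"
proof -
  have "norm (chi \<theta> - chi 0) \<le> \<delta> * norm (\<theta> - 0)"
  proof (rule field_differentiable_bound[of UNIV _ "deriv chi"])
    show "(chi has_field_derivative deriv chi z) (at z within UNIV)" for z
      using assms by (simp add: chi_deformation_def DERIV_deriv_iff_real_differentiable)
  qed (use assms in \<open>auto simp: chi_deformation_def\<close>)
  then show ?thesis
    using assms by (simp add: chi_deformation_def)
qed

lemma chi_deformation_measurable:
  assumes "chi_deformation \<delta> \<Gamma> chi"
  shows "chi \<in> borel_measurable borel"
  using assms by (intro borel_measurable_mono strict_mono_mono) (simp add: chi_deformation_def)

lemma chi_deformation_square:
  assumes chi: "chi_deformation \<delta> \<Gamma> chi"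
  shows "integrable std_normal (\<lambda>\<theta>. (chi \<theta>)\<^sup>2)" "(\<integral>\<theta>. (chi \<theta>)\<^sup>2 \<partial>std_normal) \<le> \<delta>\<^sup>2"
proof -
  note [measurable] = chi_deformation_measurable[OF chi]
  have le: "(chi \<theta>)\<^sup>2 \<le> \<delta>\<^sup>2 * \<theta>\<^sup>2" for \<theta>
    using power_mono[OF chi_deformation_abs_le[OF chi, of \<theta>], of 2] by (simp add: power_mult_distrib)
  have int: "integrable std_normal (\<lambda>\<theta>. \<delta>\<^sup>2 * \<theta>\<^sup>2)"
    using std_normal_square(1) by simp
  show 1: "integrable std_normal (\<lambda>\<theta>. (chi \<theta>)\<^sup>2)"
    using le by (intro Bochner_Integration.integrable_bound[OF int]) auto
  have "(\<integral>\<theta>. (chi \<theta>)\<^sup>2 \<partial>std_normal) \<le> (\<integral>\<theta>. \<delta>\<^sup>2 * \<theta>\<^sup>2 \<partial>std_normal)"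
    using le by (intro integral_mono 1 int)
  then show "(\<integral>\<theta>. (chi \<theta>)\<^sup>2 \<partial>std_normal) \<le> \<delta>\<^sup>2"
    using std_normal_square(2) by simp
qed

section \<open>Averaging over the couplings\<close>

text \<open>The linear term has mean zero, so it can be subtracted under the integral before moduli
  are taken; what remains is controlled by the second moment.\<close>

lemma chi_deformation_expectation_second_order:
  fixes h :: "real \<Rightarrow> complex"
  assumes chi: "chi_deformation \<delta> \<Gamma> chi"
    and int: "integrable std_normal (\<lambda>\<theta>. h (chi \<theta>))"
    and h: "\<And>x. cmod (h x - h 0 - of_real x * L) \<le> D * x\<^sup>2" and D: "0 \<le> D"
  shows "cmod ((\<integral>\<theta>. h (chi \<theta>) \<partial>std_normal) - h 0) \<le> D * \<delta>\<^sup>2"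
proof -
  interpret prob_space std_normal
    by (rule prob_space_std_normal)
  have chi_int: "integrable std_normal chi" "(\<integral>\<theta>. chi \<theta> \<partial>std_normal) = 0"
    using chi by (auto simp: chi_deformation_def)
  have "(\<integral>\<theta>. h (chi \<theta>) - h 0 - of_real (chi \<theta>) * L \<partial>std_normal) = (\<integral>\<theta>. h (chi \<theta>) \<partial>std_normal) - h 0"
    using chi_int int prob_space by simp
  then have "cmod ((\<integral>\<theta>. h (chi \<theta>) \<partial>std_normal) - h 0)
      \<le> (\<integral>\<theta>. cmod (h (chi \<theta>) - h 0 - of_real (chi \<theta>) * L) \<partial>std_normal)"
    by (metis integral_norm_bound)
  also have "\<dots> \<le> (\<integral>\<theta>. D * (chi \<theta>)\<^sup>2 \<partial>std_normal)"
    using chi_int int chi_deformation_square(1)[OF chi] h by (intro integral_mono) auto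
  also have "\<dots> \<le> D * \<delta>\<^sup>2"
    using mult_left_mono[OF chi_deformation_square(2)[OF chi] D] by simp
  finally show ?thesis .
qed

text \<open>Bounding the mixed second derivatives of \<open>F\<close> all at once would lose a factor \<open>k\<close>.\<close>

lemma expectation_second_order:
  fixes F :: "(nat \<Rightarrow> real) \<Rightarrow> complex"
  assumes chi: "\<And>i. i < k \<Longrightarrow> chi_deformation \<delta> \<Gamma> (chi i)"
    and F: "F \<in> borel_measurable (PiM UNIV (\<lambda>_. borel))"
    and bounded: "\<And>g. cmod (F g) \<le> b"
    and second_order: "\<And>g i. i < k \<Longrightarrow>
      \<exists>L. \<forall>x. cmod (F (g(i := x)) - F (g(i := 0)) - of_real x * L) \<le> D * x\<^sup>2"
    and D: "0 \<le> D"
  shows "cmod ((\<integral>\<theta>. F (\<lambda>i. if i < k then chi i (\<theta> i) else 0) \<partial>PiM {..<k} (\<lambda>_. std_normal)) - F (\<lambda>_. 0))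
    \<le> real k * D * \<delta>\<^sup>2"
  using chi second_order
proof (induction k)
  case 0
  have "prob_space (PiM {..<0::nat} (\<lambda>_. std_normal))"
    by (intro prob_space_PiM prob_space_std_normal)
  then show ?case
    by (simp add: prob_space.prob_space)
next
  case (Suc k)
  interpret N: prob_space std_normal
    by (rule prob_space_std_normal)
  interpret P: prob_space "PiM {..<k} (\<lambda>_. std_normal)"
    by (intro prob_space_PiM prob_space_std_normal)
  interpret P': prob_space "PiM {..<Suc k} (\<lambda>_. std_normal)"
    by (intro prob_space_PiM prob_space_std_normal)
  interpret product_sigma_finite "\<lambda>_::nat. std_normal"
    by standard
  \<comment> \<open>Only the first \<open>k\<close> couplings are switched on. Padding with 0 gives
    \<open>F\<close> a total argument, and passing from \<open>k\<close> to \<open>Suc k\<close>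
    changes coordinate \<open>k\<close> alone.\<close>
  define G where "G k \<theta> = (\<lambda>i. if i < k then chi i (\<theta> i) else 0)" for k and \<theta> :: "nat \<Rightarrow> real"
  have G: "G j \<in> measurable (PiM {..<j} (\<lambda>_. std_normal)) (PiM UNIV (\<lambda>_. borel))"
    if "j \<le> Suc k" for j
  proof (rule measurable_PiM_single')
    fix i
    show "(\<lambda>\<theta>. G j \<theta> i) \<in> measurable (PiM {..<j} (\<lambda>_. std_normal)) borel"
    proof (cases "i < j")
      case True
      then have [measurable]: "chi i \<in> borel_measurable borel"
        using that by (intro chi_deformation_measurable[OF Suc.prems(1)]) simp
      have [measurable]: "(\<lambda>\<theta>. \<theta> i) \<in> measurable (PiM {..<j} (\<lambda>_. std_normal)) borel"
        using measurable_component_singleton[of i "{..<j}" "\<lambda>_. std_normal"] True by simp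
      show ?thesis
        using True by (simp add: G_def)
    qed (simp add: G_def)
  qed (auto simp: space_PiM)
  have upd: "G (Suc k) (\<theta>(k := y)) = (G k \<theta>)(k := chi k y)" "(G k \<theta>)(k := 0) = G k \<theta>" for \<theta> y
    by (auto simp: G_def fun_eq_iff less_Suc_eq)
  have FG_meas: "(\<lambda>\<theta>. F (G j \<theta>)) \<in> borel_measurable (PiM {..<j} (\<lambda>_. std_normal))" if "j \<le> Suc k" for j
    using that by (rule measurable_compose[OF G F])
  have FG: "integrable (PiM {..<Suc k} (\<lambda>_. std_normal)) (\<lambda>\<theta>. F (G (Suc k) \<theta>))"
           "integrable (PiM {..<k} (\<lambda>_. std_normal)) (\<lambda>\<theta>. F (G k \<theta>))"
    using bounded FG_meas[of k] FG_meas[of "Suc k"]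
    by (auto intro: P'.integrable_const_bound[of _ b] P.integrable_const_bound[of _ b])
  \<comment> \<open>Average over coupling \<open>k\<close> with the earlier ones frozen.\<close>
  define I where "I \<theta> = (\<integral>y. F (G (Suc k) (\<theta>(k := y))) \<partial>std_normal)" for \<theta>
  have add: "(\<lambda>(\<theta>, y). \<theta>(k := y)) \<in> measurable
      (PiM {..<k} (\<lambda>_. std_normal) \<Otimes>\<^sub>M std_normal) (PiM {..<Suc k} (\<lambda>_. std_normal))"
    using measurable_add_dim[of k "{..<k}" "\<lambda>_. std_normal"] by (simp add: lessThan_Suc)
  have joint: "(\<lambda>(\<theta>, y). F (G (Suc k) (\<theta>(k := y))))
      \<in> borel_measurable (PiM {..<k} (\<lambda>_. std_normal) \<Otimes>\<^sub>M std_normal)"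
    using measurable_compose[OF add FG_meas[of "Suc k"]] by (simp add: case_prod_beta')
  have I: "I \<in> borel_measurable (PiM {..<k} (\<lambda>_. std_normal))"
    unfolding I_def by (rule N.borel_measurable_lebesgue_integral[OF joint])
  have step: "cmod (I \<theta> - F (G k \<theta>)) \<le> D * \<delta>\<^sup>2" if \<theta>: "\<theta> \<in> space (PiM {..<k} (\<lambda>_. std_normal))" for \<theta>
  proof -
    obtain L where L: "\<And>x. cmod (F ((G k \<theta>)(k := x)) - F ((G k \<theta>)(k := 0)) - of_real x * L) \<le> D * x\<^sup>2"
      using Suc.prems(2)[OF lessI, of "G k \<theta>"] by blast
    have "(\<lambda>y. F (G (Suc k) (\<theta>(k := y)))) \<in> borel_measurable std_normal"
      using measurable_Pair2[OF joint \<theta>] by simp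
    then have "integrable std_normal (\<lambda>y. F ((G k \<theta>)(k := chi k y)))"
      unfolding upd(1) using bounded by (intro N.integrable_const_bound[of _ b]) auto
    with Suc.prems(1)[OF lessI]
    have "cmod ((\<integral>y. F ((G k \<theta>)(k := chi k y)) \<partial>std_normal) - F ((G k \<theta>)(k := 0))) \<le> D * \<delta>\<^sup>2"
      by (rule chi_deformation_expectation_second_order[where h = "\<lambda>x. F ((G k \<theta>)(k := x))", OF _ _ L D])
    then show ?thesis
      unfolding I_def upd .
  qed
  have I_bound: "cmod (I \<theta>) \<le> b + D * \<delta>\<^sup>2" if "\<theta> \<in> space (PiM {..<k} (\<lambda>_. std_normal))" for \<theta>
    using step[OF that] bounded[of "G k \<theta>"] norm_triangle_sub[of "I \<theta>" "F (G k \<theta>)"] by linarith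
  have I_int: "integrable (PiM {..<k} (\<lambda>_. std_normal)) I"
    using I_bound I by (intro P.integrable_const_bound[of _ "b + D * \<delta>\<^sup>2"]) auto
  \<comment> \<open>Fubini for the product measure; this is where independence enters.\<close>
  have "(\<integral>\<theta>. F (G (Suc k) \<theta>) \<partial>PiM {..<Suc k} (\<lambda>_. std_normal)) = (\<integral>\<theta>. I \<theta> \<partial>PiM {..<k} (\<lambda>_. std_normal))"
    unfolding I_def lessThan_Suc
    by (rule product_integral_insert) (use FG(1) in \<open>auto simp: lessThan_Suc\<close>)
  \<comment> \<open>Telescoping: the first summand is the cost of switching on coupling
    \<open>k\<close>, the second is covered by the induction hypothesis.\<close>
  then have "(\<integral>\<theta>. F (G (Suc k) \<theta>) \<partial>PiM {..<Suc k} (\<lambda>_. std_normal)) - F (\<lambda>_. 0)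
      = (\<integral>\<theta>. I \<theta> - F (G k \<theta>) \<partial>PiM {..<k} (\<lambda>_. std_normal))
        + ((\<integral>\<theta>. F (G k \<theta>) \<partial>PiM {..<k} (\<lambda>_. std_normal)) - F (\<lambda>_. 0))"
    using I_int FG(2) by simp
  also have "cmod \<dots> \<le> D * \<delta>\<^sup>2 + real k * D * \<delta>\<^sup>2"
  proof (intro norm_triangle_le add_mono)
    have "cmod (\<integral>\<theta>. I \<theta> - F (G k \<theta>) \<partial>PiM {..<k} (\<lambda>_. std_normal))
        \<le> (\<integral>\<theta>. cmod (I \<theta> - F (G k \<theta>)) \<partial>PiM {..<k} (\<lambda>_. std_normal))"
      by (rule integral_norm_bound)
    also have "\<dots> \<le> D * \<delta>\<^sup>2"
      using I_int FG(2) step by (intro P.integral_le_const) auto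
    finally show "cmod (\<integral>\<theta>. I \<theta> - F (G k \<theta>) \<partial>PiM {..<k} (\<lambda>_. std_normal)) \<le> D * \<delta>\<^sup>2" .
    show "cmod ((\<integral>\<theta>. F (G k \<theta>) \<partial>PiM {..<k} (\<lambda>_. std_normal)) - F (\<lambda>_. 0)) \<le> real k * D * \<delta>\<^sup>2"
      unfolding G_def by (rule Suc.IH) (use Suc.prems in auto)
  qed
  finally show ?case
    by (simp add: G_def algebra_simps)
qed

section \<open>The perturbed Hamiltonian\<close>

text \<open>Measurability is formulated entrywise at one fixed dimension, a property preserved by
  products and exponentials.\<close>

definition measurable_entries :: "'a measure \<Rightarrow> nat \<Rightarrow> ('a \<Rightarrow> complex mat) \<Rightarrow> bool" where
  "measurable_entries M n A \<longleftrightarrow> (\<forall>x. A x \<in> carrier_mat n n) \<and>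
     (\<forall>i<n. \<forall>j<n. (\<lambda>x. A x $$ (i,j)) \<in> borel_measurable M)"

lemma measurable_entries_const: "A \<in> carrier_mat n n \<Longrightarrow> measurable_entries M n (\<lambda>_. A)"
  by (simp add: measurable_entries_def)

lemma measurable_entries_smult:
  "measurable_entries M n A \<Longrightarrow> measurable_entries M n (\<lambda>x. c \<cdot>\<^sub>m A x)"
  by (auto simp: measurable_entries_def carrier_matD[of _ n n] intro!: borel_measurable_times)

lemma measurable_entries_mult:
  assumes A: "measurable_entries M n A" and B: "measurable_entries M n B"
  shows "measurable_entries M n (\<lambda>x. A x * B x)"
  unfolding measurable_entries_def
proof (intro conjI allI impI)
  show "A x * B x \<in> carrier_mat n n" for x
    using A B by (intro mult_carrier_mat[of _ n n]) (auto simp: measurable_entries_def)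
  fix i j assume ij: "i < n" "j < n"
  have "(A x * B x) $$ (i,j) = (\<Sum>l<n. A x $$ (i,l) * B x $$ (l,j))" for x
    using A B by (intro mult_mat_index[of _ n _ _ n] ij) (auto simp: measurable_entries_def)
  then show "(\<lambda>x. (A x * B x) $$ (i,j)) \<in> borel_measurable M"
    using A B ij by (auto simp: measurable_entries_def intro!: borel_measurable_sum borel_measurable_times)
qed

lemma measurable_entries_pow:
  assumes A: "measurable_entries M n A"
  shows "measurable_entries M n (\<lambda>x. A x ^\<^sub>m k)"
proof (induction k)
  case 0
  have "A x ^\<^sub>m 0 = 1\<^sub>m n" for x
    using A by (simp add: measurable_entries_def carrier_matD[of _ n n])
  then show ?case
    using measurable_entries_const[of "1\<^sub>m n" n M] by simp
next
  case (Suc k)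
  show ?case
    using measurable_entries_mult[OF Suc A] by simp
qed

lemma measurable_entries_mat_exp:
  assumes A: "measurable_entries M n A"
  shows "measurable_entries M n (\<lambda>x. mat_exp (A x))"
  unfolding measurable_entries_def
proof (intro conjI allI impI)
  show "mat_exp (A x) \<in> carrier_mat n n" for x
    using A by (intro mat_exp_carrier) (simp add: measurable_entries_def)
  fix i j assume ij: "i < n" "j < n"
  have "mat_exp (A x) $$ (i,j) = (\<Sum>k. (A x ^\<^sub>m k) $$ (i,j) / of_nat (fact k))" for x
    using A ij by (simp add: mat_exp_def measurable_entries_def carrier_matD[of _ n n])
  moreover have "(\<lambda>x. (A x ^\<^sub>m k) $$ (i,j)) \<in> borel_measurable M" for k
    using measurable_entries_pow[OF A, of k] ij by (simp add: measurable_entries_def)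
  ultimately show "(\<lambda>x. mat_exp (A x) $$ (i,j)) \<in> borel_measurable M"
    by simp
qed

lemma borel_measurable_mtrace:
  assumes A: "measurable_entries M n A"
  shows "(\<lambda>x. mtrace (A x)) \<in> borel_measurable M"
proof -
  have "mtrace (A x) = (\<Sum>i<n. A x $$ (i,i))" for x
    using A by (simp add: mtrace_def measurable_entries_def carrier_matD[of _ n n])
  then show ?thesis
    using A by (auto simp: measurable_entries_def intro!: borel_measurable_sum)
qed

lemma measurable_entries_perturbed:
  assumes "H \<in> carrier_mat n n"
  shows "measurable_entries (PiM UNIV (\<lambda>_. borel)) n (perturbed n H M V)"
  using assms by (auto simp: measurable_entries_def perturbed_def)

lemma borel_measurable_mtrace_heis_perturbed:
  assumes "H \<in> carrier_mat n n" "Ob \<in> carrier_mat n n" "\<rho> \<in> carrier_mat n n"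
  shows "(\<lambda>g. mtrace (\<rho> * heis (perturbed n H M V g) Ob t)) \<in> borel_measurable (PiM UNIV (\<lambda>_. borel))"
  unfolding heis_def using assms
  by (intro borel_measurable_mtrace[of _ n] measurable_entries_mult measurable_entries_mat_exp
      measurable_entries_smult measurable_entries_perturbed measurable_entries_const)

section \<open>Dependence on the individual couplings\<close>

text \<open>Exhibits the affine dependence on one coupling, with the Hamiltonian at
  \<open>g i = 0\<close> as the base point of the one-variable expansion.\<close>

lemma perturbed_fun_upd:
  assumes H: "H \<in> carrier_mat n n" and V: "V i \<in> carrier_mat n n" and i: "i < M"
  shows "perturbed n H M V (g(i := x)) = perturbed n H M V (g(i := 0)) + complex_of_real x \<cdot>\<^sub>m V i"
proof (rule eq_matI)
  fix a b assume "a < dim_row (perturbed n H M V (g(i := 0)) + complex_of_real x \<cdot>\<^sub>m V i)"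
    "b < dim_col (perturbed n H M V (g(i := 0)) + complex_of_real x \<cdot>\<^sub>m V i)"
  then have ab: "a < n" "b < n"
    using V by auto
  have "(\<Sum>j<M. of_real ((g(i := y)) j) * (V j $$ (a,b)))
      = of_real y * V i $$ (a,b) + (\<Sum>j\<in>{..<M} - {i}. of_real (g j) * (V j $$ (a,b)))" for y
    using i by (subst sum.remove[of _ i]) (auto intro!: sum.cong)
  then show "perturbed n H M V (g(i := x)) $$ (a,b)
      = (perturbed n H M V (g(i := 0)) + complex_of_real x \<cdot>\<^sub>m V i) $$ (a,b)"
    using ab H V by (simp add: perturbed_def)
qed (use V in \<open>auto simp: perturbed_def\<close>)

lemma hermitian_mat_perturbed:
  assumes H: "hermitian_mat n H" and V: "\<And>i. i < M \<Longrightarrow> hermitian_mat n (V i)"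
  shows "hermitian_mat n (perturbed n H M V g)"
  unfolding hermitian_mat_def
  using hermitian_mat_carrier[OF H] hermitian_mat_index[OF H] hermitian_mat_index[OF V]
  by (auto simp: adj_def perturbed_def intro!: eq_matI sum.cong)

lemma perturbed_0: "H \<in> carrier_mat n n \<Longrightarrow> perturbed n H M V (\<lambda>_. 0) = H"
  by (auto simp: perturbed_def intro!: eq_matI)

lemma perturbed_cong:
  "(\<And>i. i < M \<Longrightarrow> g i = g' i) \<Longrightarrow> perturbed n H M V g = perturbed n H M V g'"
  by (simp add: perturbed_def)

text \<open>Every perturbed Hamiltonian is Hermitian, so
  \<open>D = 2 * t\<^sup>2 * opnorm Ob\<close> serves for each coupling whatever the values of the
  others. Summing over \<open>M\<close> couplings gives the bound with an explicit constant.\<close>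

lemma expect_heis_perturbed:
  assumes chi: "\<And>i. i < M \<Longrightarrow> chi_deformation \<delta> \<Gamma> (chi i)" and H: "hermitian_mat n H"
    and V: "\<And>i. i < M \<Longrightarrow> hermitian_mat n (V i)" "\<And>i. i < M \<Longrightarrow> opnorm (V i) \<le> 1"
    and t: "0 \<le> t" and \<rho>: "density_matrix n \<rho>" and Ob: "Ob \<in> carrier_mat n n"
  shows "cmod (expect_g M chi (\<lambda>g. mtrace (\<rho> * heis (perturbed n H M V g) Ob t))
      - mtrace (\<rho> * heis H Ob t)) \<le> 2 * real M * \<delta>\<^sup>2 * t\<^sup>2 * opnorm Ob"
proof -
  define F where "F g = mtrace (\<rho> * heis (perturbed n H M V g) Ob t)" for g
  note H' = hermitian_mat_carrier[OF H]
  have "\<rho> \<in> carrier_mat n n"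
    using \<rho> by (simp add: density_matrix_def hermitian_mat_def)
  then have meas: "F \<in> borel_measurable (PiM UNIV (\<lambda>_. borel))"
    unfolding F_def by (intro borel_measurable_mtrace_heis_perturbed H' Ob)
  have bounded: "cmod (F g) \<le> opnorm Ob" for g
    unfolding F_def by (intro cmod_mtrace_heis_le[where n = n] hermitian_mat_perturbed assms)
  have second_order: "\<exists>L. \<forall>x. cmod (F (g(i := x)) - F (g(i := 0)) - of_real x * L)
      \<le> 2 * t\<^sup>2 * opnorm Ob * x\<^sup>2" if i: "i < M" for g i
  proof -
    have upd: "perturbed n H M V (g(i := x)) = perturbed n H M V (g(i := 0)) + complex_of_real x \<cdot>\<^sub>m V i" for x
      by (rule perturbed_fun_upd[where V = V and i = i, OF H' hermitian_mat_carrier[OF V(1)[OF i]] i])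
    have herm: "hermitian_mat n (perturbed n H M V (g(i := 0)))"
      by (intro hermitian_mat_perturbed H V)
    obtain L where L: "\<And>x. cmod (mtrace (\<rho> * heis (perturbed n H M V (g(i := 0)) + complex_of_real x \<cdot>\<^sub>m V i) Ob t)
        - F (g(i := 0)) - of_real x * L) \<le> 2 * t\<^sup>2 * opnorm Ob * x\<^sup>2"
      using mtrace_heis_second_order[OF herm V(1)[OF i] V(2)[OF i] Ob \<rho> t]
      unfolding F_def by blast
    have "cmod (F (g(i := x)) - F (g(i := 0)) - of_real x * L) \<le> 2 * t\<^sup>2 * opnorm Ob * x\<^sup>2" for x
      using L[of x] unfolding F_def[of "g(i := x)"] upd[of x] .
    then show ?thesis by blast
  qed
  \<comment> \<open>\<open>perturbed\<close> reads only the first \<open>M\<close> couplings, so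
    padding by 0 beyond them changes nothing.\<close>
  have "expect_g M chi F
      = (\<integral>\<theta>. F (\<lambda>i. if i < M then chi i (\<theta> i) else 0) \<partial>PiM {..<M} (\<lambda>_. std_normal))"
    unfolding expect_g_def F_def
    by (intro Bochner_Integration.integral_cong refl arg_cong[of _ _ "\<lambda>A. mtrace (\<rho> * heis A Ob t)"] perturbed_cong) simp
  moreover have "F (\<lambda>_. 0) = mtrace (\<rho> * heis H Ob t)"
    by (simp add: F_def perturbed_0[OF H'])
  moreover have "cmod ((\<integral>\<theta>. F (\<lambda>i. if i < M then chi i (\<theta> i) else 0) \<partial>PiM {..<M} (\<lambda>_. std_normal)) - F (\<lambda>_. 0))
      \<le> real M * (2 * t\<^sup>2 * opnorm Ob) * \<delta>\<^sup>2"
    by (rule expectation_second_order[OF _ meas bounded second_order])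
      (use chi opnorm_nonneg[OF Ob] in auto)
  ultimately have "cmod (expect_g M chi F - mtrace (\<rho> * heis H Ob t)) \<le> 2 * real M * \<delta>\<^sup>2 * t\<^sup>2 * opnorm Ob"
    by (simp add: mult_ac)
  then show ?thesis
    unfolding F_def .
qed

text \<open>The order of quantifiers renders the O-notation: \<open>K\<close> and \<open>c\<close>
  are the constants of the two growth assumptions, and \<open>C\<close> is chosen from them before
  the system, the disorder, the time, the state and the observable.\<close>

theorem theorem4:
  fixes K c :: real
  assumes "K > 0" and "c > 0"
  shows "\<exists>C. \<forall>(N::nat) (M::nat) (H::complex mat) (V::nat \<Rightarrow> complex mat)
            (chi::nat \<Rightarrow> real \<Rightarrow> real) (\<delta>::real) (\<Gamma>::ereal) (t::real)
            (\<rho>::complex mat) (Ob::complex mat).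
     real M \<le> K * real N \<longrightarrow>
     \<delta> > 0 \<longrightarrow> \<Gamma> > 0 \<longrightarrow>
     (\<forall>i<M. chi_deformation \<delta> \<Gamma> (chi i)) \<longrightarrow>
     hermitian_mat (2^N) H \<longrightarrow>
     (\<forall>i<M. hermitian_mat (2^N) (V i) \<and> opnorm (V i) \<le> 1) \<longrightarrow>
     t \<ge> 0 \<longrightarrow> sqrt (real N) * t * \<delta> \<le> c \<longrightarrow>
     density_matrix (2^N) \<rho> \<longrightarrow>
     hermitian_mat (2^N) Ob \<longrightarrow>
     cmod (expect_g M chi (\<lambda>g. mtrace (\<rho> * heis (perturbed (2^N) H M V g) Ob t))
           - mtrace (\<rho> * heis H Ob t))
       \<le> C * real N * \<delta>\<^sup>2 * t\<^sup>2 * opnorm Ob"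
proof (intro exI[of _ "2 * K"] allI impI)
  fix N M :: nat and H :: "complex mat" and V :: "nat \<Rightarrow> complex mat"
    and chi :: "nat \<Rightarrow> real \<Rightarrow> real" and \<delta> :: real and \<Gamma> :: ereal and t :: real
    and \<rho> Ob :: "complex mat"
  assume M: "real M \<le> K * real N"
    and chi: "\<forall>i<M. chi_deformation \<delta> \<Gamma> (chi i)" and H: "hermitian_mat (2^N) H"
    and V: "\<forall>i<M. hermitian_mat (2^N) (V i) \<and> opnorm (V i) \<le> 1"
    and t: "t \<ge> 0" and \<rho>: "density_matrix (2^N) \<rho>" and Ob: "hermitian_mat (2^N) Ob"
  note Ob' = hermitian_mat_carrier[OF Ob]
  have "cmod (expect_g M chi (\<lambda>g. mtrace (\<rho> * heis (perturbed (2^N) H M V g) Ob t))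
      - mtrace (\<rho> * heis H Ob t)) \<le> 2 * real M * \<delta>\<^sup>2 * t\<^sup>2 * opnorm Ob"
    by (rule expect_heis_perturbed[OF _ H _ _ t \<rho> Ob']) (use chi V in auto)
  \<comment> \<open>The bound \<open>M \<le> K * N\<close> on the number of couplings turns the
    factor \<open>2 * M\<close> into \<open>2 * K * N\<close>, which explains the witness
    \<open>2 * K\<close>.\<close>
  also have "\<dots> \<le> 2 * (K * real N) * \<delta>\<^sup>2 * t\<^sup>2 * opnorm Ob"
    using M opnorm_nonneg[OF Ob'] by (intro mult_right_mono) auto
  finally show "cmod (expect_g M chi (\<lambda>g. mtrace (\<rho> * heis (perturbed (2^N) H M V g) Ob t))
      - mtrace (\<rho> * heis H Ob t)) \<le> 2 * K * real N * \<delta>\<^sup>2 * t\<^sup>2 * opnorm Ob"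
    by (simp only: mult.assoc)
qed

end
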